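(* Let $(a_n)_{n\in\mathbb N}\subset(1,\infty)$ be a sequence of real numbers. Then the following conditions are equivalent: (i) $\sum_{n\in\mathbb N}a_n^{-1}=\infty$. (ii) There are a free filter $\mathfrak F$ on $\mathbb N$, an infinite-dimensional real Banach space $X$ and an $\mathfrak F$-basis $(u_k)_{k\in\mathbb N}$ of $X$ with continuous coordinate functionals such that the partial sums operators $S_n$ with respect to $(u_k)_{k\in\mathbb N}$ satisfy $\|S_n\|=a_n$ for all $n\in\mathbb N$. (iii) For $s=(a_n^{-1})_{n\in\mathbb N}$, there is an $\mathfrak F^{s}$-basis $(u_k)_{k\in\mathbb N}$ of $\ell_1$ with continuous coordinate functionals such that the partial sums operators $S_n$ with respect to $(u_k)_{k\in\mathbb N}$ satisfy $\|S_n\|=a_n$ for all $n\in\mathbb N$.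
   Context: All Banach spaces are real. A filter $\mathfrak F$ on $\mathbb N$ is a non-empty family of subsets of $\mathbb N$ with $\emptyset\notin\mathfrak F$, closed under finite intersections and supersets; it is free if it contains every subset of $\mathbb N$ with finite complement. A sequence $(x_n)$ in a topological space is $\mathfrak F$-convergent to $x$ (written $\lim_{\mathfrak F}x_n=x$) if $\{n\in\mathbb N:x_n\in U\}\in\mathfrak F$ for every neighborhood $U$ of $x$. $\mathfrak F$-basis: for a free filter $\mathfrak F$ on $\mathbb N$, a sequence $(u_k)_{k\in\mathbb N}$ in a Banach space $X$ is an $\mathfrak F$-basis of $X$ if for every $x\in X$ there is a unique sequence of scalars $(c_k)$ such that the partial sums $\sum_{k=1}^n c_k u_k$ are $\mathfrak F$-convergent (in $n$) in norm to $x$. The coordinate functionals are the linear maps $u_k^*:x\mapsto c_k$, and the partial sums operators are $S_n(x)=\sum_{k=1}^n u_k^*(x)u_k$. When the coordinate functionals are continuous, $S_n$ is a bounded operator and $\|S_n\|$ is its operator norm. Summable filter: for a sequence $s=(s_k)$ of non-negative reals with $\sum_{k=1}^\infty s_k=\infty$, $\mathfrak F^{s}$ is the free filter of all $A\subset\mathbb N$ with $\sum_{k\in\mathbb N\setminus A}s_k<\infty$. Condition (iii) is understood to include the requirement that $\mathfrak F^s$ is defined (i.e. $\sum_k s_k=\infty$). *)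

theory Defs
  imports "HOL-Analysis.Analysis" "HOL-Library.Function_Algebras"
begin

section \<open>Sequences as a real vector space\<close>

instantiation "fun" :: (type, real_vector) real_vector
begin

definition "r *\<^sub>R f = (\<lambda>x. r *\<^sub>R f x)"

instance
  by standard (simp_all add: scaleR_fun_def fun_eq_iff scaleR_add_right scaleR_add_left)

end

lemma scaleR_fun_apply [simp]: "(r *\<^sub>R f) x = r *\<^sub>R f x"
  by (simp add: scaleR_fun_def)


section \<open>Banach spaces with an explicit carrier\<close>

text \<open>
  Types cannot be quantified over, so a Banach space is a linear subspace \<open>X\<close> of an ambient real
  vector space together with a complete norm \<open>N\<close> on \<open>X\<close>. The ambient type carries no topology, and
  \<open>N\<close> is unrelated to any norm that it may have. The values of \<open>N\<close> outside \<open>X\<close> are irrelevant: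
  \<open>norm_dist\<close> is cut off there only because the library locale \<^locale>\<open>Metric_space\<close> requires
  nonnegativity and symmetry on the whole type.

  Every Banach space with a filter basis is isometrically isomorphic to one carried by a linear
  subspace of \<open>nat \<Rightarrow> real\<close> (send each vector to its coordinate sequence and transport the norm), so
  an existential statement about such spaces loses nothing by taking \<open>nat \<Rightarrow> real\<close> as ambient type.
\<close>

definition norm_dist :: "'v::real_vector set \<Rightarrow> ('v \<Rightarrow> real) \<Rightarrow> 'v \<Rightarrow> 'v \<Rightarrow> real" where
  "norm_dist X N x y = (if x \<in> X \<and> y \<in> X then N (x - y) else 0)"

definition norm_topology :: "'v::real_vector set \<Rightarrow> ('v \<Rightarrow> real) \<Rightarrow> 'v topology" where
  "norm_topology X N = Metric_space.mtopology X (norm_dist X N)"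

locale normed_space_on =
  fixes X :: "'v::real_vector set" and N :: "'v \<Rightarrow> real"
  assumes subspace_carrier: "subspace X"
    and norm_nonneg: "x \<in> X \<Longrightarrow> 0 \<le> N x"
    and norm_eq_0: "x \<in> X \<Longrightarrow> N x = 0 \<longleftrightarrow> x = 0"
    and norm_scale: "x \<in> X \<Longrightarrow> N (r *\<^sub>R x) = \<bar>r\<bar> * N x"
    and norm_triangle: "x \<in> X \<Longrightarrow> y \<in> X \<Longrightarrow> N (x + y) \<le> N x + N y"
begin

sublocale Metric_space X "norm_dist X N"
proof
  fix x y z
  have minus: "N (y - x) = N (x - y)" if "x \<in> X" "y \<in> X" for x y
    using norm_scale[of "x - y" "-1"] subspace_diff[OF subspace_carrier that] by simp
  show "0 \<le> norm_dist X N x y"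
    by (simp add: norm_dist_def norm_nonneg subspace_diff[OF subspace_carrier])
  show "norm_dist X N x y = norm_dist X N y x"
    by (simp add: norm_dist_def minus)
  show "norm_dist X N x y = 0 \<longleftrightarrow> x = y" if "x \<in> X" "y \<in> X"
    using that by (simp add: norm_dist_def norm_eq_0 subspace_diff[OF subspace_carrier])
  show "norm_dist X N x z \<le> norm_dist X N x y + norm_dist X N y z"
    if "x \<in> X" "y \<in> X" "z \<in> X"
    using that norm_triangle[of "x - y" "y - z"] subspace_diff[OF subspace_carrier]
    by (simp add: norm_dist_def)
qed

end

locale banach_space_on = normed_space_on +
  assumes complete: "Metric_space.mcomplete X (norm_dist X N)"

definition infinite_dimensional :: "'v::real_vector set \<Rightarrow> bool" where
  "infinite_dimensional X \<longleftrightarrow> \<not> (\<exists>B. finite B \<and> X \<subseteq> span B)"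

definition op_norm :: "'v::real_vector set \<Rightarrow> ('v \<Rightarrow> real) \<Rightarrow> ('v \<Rightarrow> 'v) \<Rightarrow> real" where
  "op_norm X N T = (SUP x\<in>{x \<in> X. N x \<le> 1}. N (T x))"

lemma banach_space_on_UNIV: "banach_space_on (UNIV :: 'a::banach set) norm"
proof -
  interpret normed_space_on "UNIV :: 'a set" norm
    by standard (auto intro: norm_triangle_ineq)
  have "norm_dist (UNIV :: 'a set) norm = dist"
    by (simp add: norm_dist_def dist_norm fun_eq_iff)
  then have "Metric_space.mcomplete (UNIV :: 'a set) (norm_dist UNIV norm)"
    by (simp add: complete_UNIV)
  then show ?thesis
    by unfold_locales
qed


section \<open>The space of absolutely summable sequences\<close>

definition l1_space :: "(nat \<Rightarrow> real) set" where
  "l1_space = {x. summable (\<lambda>k. \<bar>x k\<bar>)}"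

definition l1_norm :: "(nat \<Rightarrow> real) \<Rightarrow> real" where
  "l1_norm x = (\<Sum>k. \<bar>x k\<bar>)"

lemma normed_space_on_l1: "normed_space_on l1_space l1_norm"
proof
  have add: "summable (\<lambda>k. \<bar>x k + y k\<bar>)"
    if "summable (\<lambda>k. \<bar>x k\<bar>)" "summable (\<lambda>k. \<bar>y k\<bar>)" for x y :: "nat \<Rightarrow> real"
    by (rule summable_comparison_test'[OF summable_add[OF that], of 0]) auto
  show "subspace l1_space"
    by (auto simp: subspace_def l1_space_def add abs_mult intro: summable_mult)
  show "0 \<le> l1_norm x" if "x \<in> l1_space" for x
    using that by (auto simp: l1_space_def l1_norm_def intro: suminf_nonneg)
  show "l1_norm x = 0 \<longleftrightarrow> x = 0" if "x \<in> l1_space" for x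
    using that by (simp add: l1_space_def l1_norm_def suminf_eq_zero_iff fun_eq_iff)
  show "l1_norm (r *\<^sub>R x) = \<bar>r\<bar> * l1_norm x" if "x \<in> l1_space" for r x
    using that by (simp add: l1_space_def l1_norm_def abs_mult suminf_mult)
  show "l1_norm (x + y) \<le> l1_norm x + l1_norm y" if "x \<in> l1_space" "y \<in> l1_space" for x y
    using that by (auto simp: l1_space_def l1_norm_def suminf_add intro!: suminf_le add summable_add)
qed

lemma banach_space_on_l1: "banach_space_on l1_space l1_norm"
proof -
  interpret l1: normed_space_on l1_space l1_norm
    by (rule normed_space_on_l1)
  have partial_le: "(\<Sum>k<m. \<bar>x k\<bar>) \<le> l1_norm x" if "x \<in> l1_space" for x m
    using that by (auto simp: l1_space_def l1_norm_def intro: sum_le_suminf)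
  have "\<exists>y. limitin l1.mtopology \<sigma> y sequentially" if "l1.MCauchy \<sigma>" for \<sigma>
  proof -
    have in_l1: "\<sigma> n \<in> l1_space" for n
      using that by (auto simp: l1.MCauchy_def)
    then have diff: "\<sigma> m - \<sigma> n \<in> l1_space" for m n
      by (simp add: subspace_diff[OF l1.subspace_carrier])
    have cauchy: "\<exists>M. \<forall>n\<ge>M. \<forall>n'\<ge>M. l1_norm (\<sigma> n - \<sigma> n') < e" if "e > 0" for e
      using \<open>l1.MCauchy \<sigma>\<close> that in_l1 unfolding l1.MCauchy_def norm_dist_def by simp
    have coord_le: "\<bar>\<sigma> n k - \<sigma> n' k\<bar> \<le> l1_norm (\<sigma> n - \<sigma> n')" for n n' k
    proof -
      have "\<bar>\<sigma> n k - \<sigma> n' k\<bar> \<le> (\<Sum>i<Suc k. \<bar>(\<sigma> n - \<sigma> n') i\<bar>)"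
        by (simp add: sum_nonneg)
      also have "\<dots> \<le> l1_norm (\<sigma> n - \<sigma> n')"
        by (rule partial_le[OF diff])
      finally show ?thesis .
    qed
    have "Cauchy (\<lambda>n. \<sigma> n k)" for k
      unfolding Cauchy_def dist_real_def
      using cauchy coord_le by (meson le_less_trans)
    then have "\<forall>k. \<exists>l. (\<lambda>n. \<sigma> n k) \<longlonglongrightarrow> l"
      by (simp add: Cauchy_convergent_iff convergent_def)
    then obtain y where y: "\<And>k. (\<lambda>n. \<sigma> n k) \<longlonglongrightarrow> y k"
      by metis
    have close: "\<exists>M. \<forall>n\<ge>M. \<sigma> n - y \<in> l1_space \<and> l1_norm (\<sigma> n - y) \<le> e" if "e > 0" for e
    proof -
      obtain M where M: "\<And>n n'. n \<ge> M \<Longrightarrow> n' \<ge> M \<Longrightarrow> l1_norm (\<sigma> n - \<sigma> n') < e"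
        using cauchy[OF \<open>e > 0\<close>] by blast
      have part: "(\<Sum>k<m. \<bar>(\<sigma> n - y) k\<bar>) \<le> e" if "n \<ge> M" for n m
      proof (rule LIMSEQ_le_const2)
        show "(\<lambda>n'. \<Sum>k<m. \<bar>\<sigma> n k - \<sigma> n' k\<bar>) \<longlonglongrightarrow> (\<Sum>k<m. \<bar>(\<sigma> n - y) k\<bar>)"
          using y by (auto intro!: tendsto_intros)
        show "\<exists>M'. \<forall>n'\<ge>M'. (\<Sum>k<m. \<bar>\<sigma> n k - \<sigma> n' k\<bar>) \<le> e"
          using M[OF that] partial_le[OF diff, of n _ m]
          by (metis (no_types, lifting) less_imp_le minus_apply order.trans sum.cong)
      qed
      have "\<sigma> n - y \<in> l1_space \<and> l1_norm (\<sigma> n - y) \<le> e" if "n \<ge> M" for n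
      proof -
        have s: "summable (\<lambda>k. \<bar>(\<sigma> n - y) k\<bar>)"
          using part[OF that] by (intro summableI_nonneg_bounded) auto
        then show ?thesis
          using part[OF that] by (auto simp: l1_space_def l1_norm_def intro: suminf_le_const)
      qed
      then show ?thesis
        by blast
    qed
    obtain M where "\<sigma> M - y \<in> l1_space"
      using close[of 1] by auto
    then have y_l1: "y \<in> l1_space"
      using subspace_diff[OF l1.subspace_carrier in_l1[of M]] by fastforce
    have "limitin l1.mtopology \<sigma> y sequentially"
      unfolding l1.limitin_metric
    proof (intro conjI allI impI y_l1)
      fix e :: real
      assume "e > 0"
      then obtain M where "\<forall>n\<ge>M. l1_norm (\<sigma> n - y) \<le> e / 2"
        using close[of "e / 2"] by auto
      with \<open>e > 0\<close> have "\<forall>n\<ge>M. l1_norm (\<sigma> n - y) < e"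
        by fastforce
      then show "\<forall>\<^sub>F n in sequentially. \<sigma> n \<in> l1_space \<and> norm_dist l1_space l1_norm (\<sigma> n) y < e"
        using in_l1 y_l1 unfolding norm_dist_def eventually_sequentially by auto
    qed
    then show ?thesis by blast
  qed
  then have "l1.mcomplete"
    by (simp add: l1.mcomplete_def)
  then show ?thesis
    by unfold_locales
qed


section \<open>Free filters and summable filters\<close>

text \<open>
  A set \<open>A\<close> belongs to the filter \<open>F\<close> iff \<open>eventually (\<lambda>n. n \<in> A) F\<close>. The improper filter \<^term>\<open>bot\<close> has
  to be excluded explicitly.
\<close>

definition free_filter :: "nat filter \<Rightarrow> bool" where
  "free_filter F \<longleftrightarrow> F \<noteq> bot \<and> (\<forall>A. finite (- A) \<longrightarrow> eventually (\<lambda>n. n \<in> A) F)"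

definition summable_filter :: "(nat \<Rightarrow> real) \<Rightarrow> nat filter" where
  "summable_filter s = Abs_filter (\<lambda>P. s summable_on {k. \<not> P k})"

lemma eventually_summable_filter:
  "eventually P (summable_filter s) \<longleftrightarrow> s summable_on {k. \<not> P k}"
  unfolding summable_filter_def
proof (rule eventually_Abs_filter, rule is_filter.intro)
  show "s summable_on {k. \<not> True}"
    by simp
  show "s summable_on {k. \<not> (P k \<and> Q k)}"
    if "s summable_on {k. \<not> P k}" "s summable_on {k. \<not> Q k}" for P Q
  proof -
    have "s summable_on {k. \<not> Q k} - {k. \<not> P k}"
      using that(2) by (rule summable_on_subset_banach) auto
    then have "s summable_on {k. \<not> P k} \<union> ({k. \<not> Q k} - {k. \<not> P k})"
      by (intro summable_on_Un_disjoint that(1)) auto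
    then show ?thesis
      by (rule back_subst[of "\<lambda>A. s summable_on A"]) auto
  qed
  show "s summable_on {k. \<not> Q k}"
    if "\<forall>k. P k \<longrightarrow> Q k" "s summable_on {k. \<not> P k}" for P Q
    using that by (auto intro: summable_on_subset_banach)
qed

lemma free_filter_summable_filter:
  assumes "\<And>k. 0 \<le> s k" "\<not> summable s"
  shows "free_filter (summable_filter s)"
proof -
  have "\<not> s summable_on UNIV"
    using assms(2) summable_on_UNIV_nonneg_real_iff[of s] assms(1) by blast
  then have "summable_filter s \<noteq> bot"
    by (auto simp: eventually_summable_filter simp flip: eventually_False)
  moreover have "{k. k \<notin> A} = - A" for A :: "nat set"
    by auto
  ultimately show ?thesis
    by (auto simp: free_filter_def eventually_summable_filter)
qed


section \<open>Bases with respect to a filter\<close>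

text \<open>
  Sequences are indexed from \<open>0\<close>, so the \<open>n\<close>-th partial sum consists of the terms \<open>0, \<dots>, n\<close>:
  index \<open>n\<close> here is index \<open>n + 1\<close> in \<open>\<nat> = {1, 2, \<dots>}\<close>.
\<close>

definition filter_expansion ::
    "nat filter \<Rightarrow> 'v::real_vector set \<Rightarrow> ('v \<Rightarrow> real) \<Rightarrow> (nat \<Rightarrow> 'v) \<Rightarrow> 'v \<Rightarrow> (nat \<Rightarrow> real) \<Rightarrow> bool" where
  "filter_expansion F X N u x c \<longleftrightarrow>
     limitin (norm_topology X N) (\<lambda>n. \<Sum>k\<le>n. c k *\<^sub>R u k) x F"

definition filter_basis ::
    "nat filter \<Rightarrow> 'v::real_vector set \<Rightarrow> ('v \<Rightarrow> real) \<Rightarrow> (nat \<Rightarrow> 'v) \<Rightarrow> bool" where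
  "filter_basis F X N u \<longleftrightarrow>
     (\<forall>k. u k \<in> X) \<and> (\<forall>x\<in>X. \<exists>!c. filter_expansion F X N u x c)"

definition coord ::
    "nat filter \<Rightarrow> 'v::real_vector set \<Rightarrow> ('v \<Rightarrow> real) \<Rightarrow> (nat \<Rightarrow> 'v) \<Rightarrow> nat \<Rightarrow> 'v \<Rightarrow> real" where
  "coord F X N u k x = (THE c. filter_expansion F X N u x c) k"

definition continuous_coords ::
    "nat filter \<Rightarrow> 'v::real_vector set \<Rightarrow> ('v \<Rightarrow> real) \<Rightarrow> (nat \<Rightarrow> 'v) \<Rightarrow> bool" where
  "continuous_coords F X N u \<longleftrightarrow>
     (\<forall>k. continuous_map (norm_topology X N) euclideanreal (coord F X N u k))"

definition partial_sum_op ::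
    "nat filter \<Rightarrow> 'v::real_vector set \<Rightarrow> ('v \<Rightarrow> real) \<Rightarrow> (nat \<Rightarrow> 'v) \<Rightarrow> nat \<Rightarrow> 'v \<Rightarrow> 'v" where
  "partial_sum_op F X N u n x = (\<Sum>k\<le>n. coord F X N u k x *\<^sub>R u k)"

end

theory Submission
  imports Defs
begin

text \<open>
  \<^bold>\<open>Divergence is necessary.\<close> Let \<open>S n\<close> be the partial sums operators of a filter basis with continuous
  coordinates, and suppose that \<open>\<Sum>n. 1 / \<parallel>S n\<parallel>\<close> converges. An expansion converges along a free filter,
  so every vector \<open>z\<close> has infinitely many \<open>n\<close> with \<open>\<parallel>S n z\<parallel> < \<parallel>z\<parallel> + 1/2\<close>. It is enough to find a
  vector of norm less than \<open>1/4\<close> with \<open>\<parallel>S n z\<parallel> \<ge> 1\<close> for all large \<open>n\<close>. Composing \<open>S n\<close> with a norming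
  functional gives functionals \<open>\<phi> n\<close> of norm about \<open>\<parallel>S n\<parallel>\<close>, and the requirement \<open>\<bar>\<phi> n z\<bar> \<ge> 1\<close> says that
  \<open>z\<close> avoids a plank of width about \<open>1 / \<parallel>S n\<parallel>\<close>. By Ball's plank theorem, symmetric planks of small
  total width cannot cover the unit ball. The exact constant does not matter for the present purpose,
  which permits a short proof losing a factor \<open>2\<close> (\<open>plank_theorem\<close>):

  \<^item> For finitely many planks the claim concerns the matrix \<open>H i k = \<phi> i (x k) / \<phi> i (x i)\<close>, where
    \<open>x i\<close> almost norms \<open>\<phi> i\<close> (\<open>finite_plank\<close>). For a symmetric matrix a choice of signs maximising
    the quadratic form does the job (Bang, \<open>bang_sign_choice\<close>). A general matrix becomes symmetric
    after multiplication by a suitable orthogonal matrix from the right and a positive diagonal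
    matrix from the left, and this can be done without losing more than half of the
    diagonal (\<open>symmetrize_rotation\<close>).

  \<^item> The solutions for the first \<open>n\<close> planks are combinations of the \<open>x k\<close> whose coefficients have
    uniformly small tails, so a subsequence converges to a solution for all planks
    (\<open>combinations_convergent_subsequence\<close>).

  \<^bold>\<open>Divergence is sufficient.\<close> Let \<open>e n\<close> be the unit vectors of the space of absolutely summable
  sequences and put \<open>u 0 = e 0\<close>, \<open>u (n + 1) = e (n + 1) - b n u n\<close>. The coordinate functionals are
  \<open>x k + b k x (k + 1)\<close>, and telescoping gives
  \<open>S n x = (x 0, \<dots>, x n, 0, \<dots>) + b n x (n + 1) u n\<close>. The numbers \<open>b n\<close> are determined by
  \<open>b n \<parallel>u n\<parallel> = a n\<close>; since \<open>a n > 1\<close>, the column \<open>S n (e (n + 1)) = b n u n\<close> is the longest one, so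
  \<open>\<parallel>S n\<parallel> = a n\<close>. The distance of \<open>S n x\<close> to the truncation of \<open>x\<close> is \<open>a n \<bar>x (n + 1)\<bar>\<close>. On the set
  where it is at least \<open>\<epsilon>\<close> one has \<open>1 / a n \<le> \<bar>x (n + 1)\<bar> / \<epsilon>\<close>, which is summable, so that set is
  negligible for the summable filter of \<open>1 / a n\<close>.
\<close>

section \<open>A plank theorem for matrices\<close>

text \<open>
  Isolates the dependence on the coordinate \<open>d i\<close>, so that the effect of changing its sign can be read
  off.
\<close>

lemma quadratic_form_split:
  fixes P :: "nat \<Rightarrow> nat \<Rightarrow> real"
  assumes sym: "\<And>i j. i < n \<Longrightarrow> j < n \<Longrightarrow> P i j = P j i" and i: "i < n"
  shows "(\<Sum>k<n. \<Sum>j<n. P k j * d k * d j) =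
    (\<Sum>k\<in>{..<n}-{i}. \<Sum>j\<in>{..<n}-{i}. P k j * d k * d j)
     + 2 * d i * (\<Sum>j\<in>{..<n}-{i}. P i j * d j) + P i i * (d i)\<^sup>2"
proof -
  have rem: "(\<Sum>j<n. g j) = g i + (\<Sum>j\<in>{..<n}-{i}. g j)" for g :: "nat \<Rightarrow> real"
    using i by (intro sum.remove) auto
  have "(\<Sum>k\<in>{..<n}-{i}. P k i * d k * d i) = d i * (\<Sum>j\<in>{..<n}-{i}. P i j * d j)"
    unfolding sum_distrib_left using sym i by (intro sum.cong) auto
  moreover have "(\<Sum>j\<in>{..<n}-{i}. P i j * d i * d j) = d i * (\<Sum>j\<in>{..<n}-{i}. P i j * d j)"
    unfolding sum_distrib_left by (intro sum.cong) auto
  ultimately show ?thesis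
    by (simp add: rem sum.distrib power2_eq_square algebra_simps)
qed

text \<open>
  Bang's lemma for planks centred at the origin. Among the vectors with entries \<open>\<plusminus> e i\<close> take one that
  maximises the quadratic form of \<open>P\<close>: no single sign change can increase the form, and this is exactly
  the claimed lower bound for each coordinate of \<open>P d\<close>.
\<close>

lemma bang_sign_choice:
  fixes P :: "nat \<Rightarrow> nat \<Rightarrow> real" and e :: "nat \<Rightarrow> real"
  assumes sym: "\<And>i j. i < n \<Longrightarrow> j < n \<Longrightarrow> P i j = P j i" and e: "\<And>i. i < n \<Longrightarrow> 0 < e i"
  shows "\<exists>d. (\<forall>i<n. \<bar>d i\<bar> = e i) \<and> (\<forall>i<n. P i i * e i \<le> \<bar>\<Sum>j<n. P i j * d j\<bar>)"
proof -
  define D where "D = (PiE {..<n} (\<lambda>i. {e i, - e i}))"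
  define Q where "Q d = (\<Sum>k<n. \<Sum>j<n. P k j * d k * d j)" for d
  have "finite D" unfolding D_def by (intro finite_PiE) auto
  moreover have "D \<noteq> {}" unfolding D_def by (simp add: PiE_eq_empty_iff)
  ultimately have fin: "finite (Q ` D)" "Q ` D \<noteq> {}" by simp_all
  obtain d where d_in: "d \<in> D" and d_eq: "Max (Q ` D) = Q d"
    using Max_in[OF fin] by (rule imageE) blast
  have d_max: "Q d' \<le> Q d" if "d' \<in> D" for d'
    using Max_ge[OF fin(1) imageI[OF that]] unfolding d_eq .
  have abs_d: "\<bar>d i\<bar> = e i" if "i < n" for i
  proof -
    have "d i = e i \<or> d i = - e i"
      using d_in that by (simp add: D_def PiE_iff)
    then show ?thesis using e[OF that] by auto
  qed
  have "P i i * e i \<le> \<bar>\<Sum>j<n. P i j * d j\<bar>" if i: "i < n" for i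
  proof -
    define R where "R = (\<Sum>j\<in>{..<n}-{i}. P i j * d j)"
    have "d(i := - d i) \<in> D"
      using d_in i by (auto simp: D_def PiE_iff extensional_def)
    then have "Q (d(i := - d i)) \<le> Q d" by (rule d_max)
    \<comment> \<open>Flipping one sign only changes the mixed terms, so maximality makes their sum nonnegative.\<close>
    moreover have "Q (d(i := - d i)) - Q d = - 4 * (d i * R)"
    proof -
      define A where "A = (\<Sum>k\<in>{..<n}-{i}. \<Sum>j\<in>{..<n}-{i}. P k j * d k * d j)"
      have A': "(\<Sum>k\<in>{..<n}-{i}. \<Sum>j\<in>{..<n}-{i}. P k j * (d(i := - d i)) k * (d(i := - d i)) j) = A"
        unfolding A_def by (intro sum.cong) auto
      have R': "(\<Sum>j\<in>{..<n}-{i}. P i j * (d(i := - d i)) j) = R"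
        unfolding R_def by (intro sum.cong) auto
      have split: "Q d' = (\<Sum>k\<in>{..<n}-{i}. \<Sum>j\<in>{..<n}-{i}. P k j * d' k * d' j)
          + 2 * d' i * (\<Sum>j\<in>{..<n}-{i}. P i j * d' j) + P i i * (d' i)\<^sup>2" for d'
        unfolding Q_def using sym i by (rule quadratic_form_split)
      have "Q (d(i := - d i)) = A + 2 * (- d i) * R + P i i * (d i)\<^sup>2"
        unfolding split[of "d(i := - d i)"] A' R' by simp
      moreover have "Q d = A + 2 * d i * R + P i i * (d i)\<^sup>2"
        unfolding split[of d] A_def R_def ..
      ultimately show ?thesis by simp
    qed
    ultimately have pos: "0 \<le> d i * R" by simp
    have "(\<Sum>j<n. P i j * d j) = P i i * d i + R"
      unfolding R_def using i by (intro sum.remove) auto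
    then have "d i * (\<Sum>j<n. P i j * d j) = P i i * (d i)\<^sup>2 + d i * R"
      by (simp only: algebra_simps power2_eq_square)
    then have "d i * (\<Sum>j<n. P i j * d j) = P i i * (e i)\<^sup>2 + d i * R"
      using abs_d[OF i] by (metis power2_abs)
    then have "P i i * (e i)\<^sup>2 \<le> \<bar>d i\<bar> * \<bar>\<Sum>j<n. P i j * d j\<bar>"
      using pos abs_ge_self[of "d i * (\<Sum>j<n. P i j * d j)"]
      unfolding abs_mult[symmetric] by linarith
    then have "e i * (P i i * e i) \<le> e i * \<bar>\<Sum>j<n. P i j * d j\<bar>"
      unfolding abs_d[OF i] by (simp only: power2_eq_square mult_ac)
    then show ?thesis
      using e[OF i] by simp
  qed
  with abs_d show ?thesis by (intro exI[of _ d] conjI allI impI)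
qed

text \<open>
  The vectors \<open>v 0, \<dots>, v (n - 1)\<close> are the columns of an orthogonal matrix of size \<open>n\<close>; values at indices
  from \<open>n\<close> on are arbitrary. The size is a number and not a type because it grows to infinity later.
\<close>

definition orthonormal_family :: "nat \<Rightarrow> (nat \<Rightarrow> nat \<Rightarrow> real) \<Rightarrow> bool" where
  "orthonormal_family n v \<longleftrightarrow>
     (\<forall>i<n. \<forall>j<n. (\<Sum>k<n. v i k * v j k) = (if i = j then 1 else 0))"

text \<open>
  A rotation by the angle \<open>t\<close> in the plane of the \<open>i\<close>-th and the \<open>j\<close>-th vector (a Givens rotation).
\<close>

definition rotate_pair :: "nat \<Rightarrow> nat \<Rightarrow> real \<Rightarrow> (nat \<Rightarrow> nat \<Rightarrow> real) \<Rightarrow> nat \<Rightarrow> nat \<Rightarrow> real" where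
  "rotate_pair i j t v =
     v(i := (\<lambda>k. cos t * v i k + sin t * v j k), j := (\<lambda>k. cos t * v j k - sin t * v i k))"

lemma orthonormal_family_rotate_pair:
  assumes v: "orthonormal_family n v" and ij: "i < n" "j < n" "i \<noteq> j"
  shows "orthonormal_family n (rotate_pair i j t v)"
proof -
  have ip: "(\<Sum>k<n. v p k * v q k) = (if p = q then 1 else 0)" if "p < n" "q < n" for p q
    using v that by (auto simp: orthonormal_family_def)
  have lin: "(\<Sum>k<n. (a * f k + b * g k) * h k) = a * (\<Sum>k<n. f k * h k) + b * (\<Sum>k<n. g k * h k)"
    "(\<Sum>k<n. h k * (a * f k + b * g k)) = a * (\<Sum>k<n. h k * f k) + b * (\<Sum>k<n. h k * g k)"
    "(\<Sum>k<n. (a * f k - b * g k) * h k) = a * (\<Sum>k<n. f k * h k) - b * (\<Sum>k<n. g k * h k)"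
    "(\<Sum>k<n. h k * (a * f k - b * g k)) = a * (\<Sum>k<n. h k * f k) - b * (\<Sum>k<n. h k * g k)"
    for a b :: real and f g h :: "nat \<Rightarrow> real"
    by (simp_all add: algebra_simps sum.distrib sum_subtractf sum_distrib_left)
  show ?thesis
    unfolding orthonormal_family_def rotate_pair_def
    using ij sin_cos_squared_add3[of t] by (auto simp: lin ip add.commute)
qed

lemma orthonormal_family_entry_le:
  assumes "orthonormal_family n v" "i < n" "k < n"
  shows "\<bar>v i k\<bar> \<le> 1"
proof -
  have "(v i k)\<^sup>2 \<le> (\<Sum>k<n. (v i k)\<^sup>2)"
    using assms by (intro member_le_sum) auto
  also have "\<dots> = 1"
    using assms by (simp add: orthonormal_family_def power2_eq_square)
  finally show ?thesis by (simp add: abs_square_le_1)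
qed

lemma orthonormal_family_isometric:
  assumes "orthonormal_family n v"
  shows "(\<Sum>k<n. (\<Sum>j<n. v j k * d j)\<^sup>2) = (\<Sum>j<n. (d j)\<^sup>2)"
proof -
  have "(\<Sum>k<n. (\<Sum>j<n. v j k * d j)\<^sup>2) = (\<Sum>k<n. \<Sum>i<n. \<Sum>j<n. d i * d j * (v i k * v j k))"
    by (simp add: power2_eq_square sum_product mult_ac)
  also have "\<dots> = (\<Sum>i<n. \<Sum>j<n. d i * d j * (\<Sum>k<n. v i k * v j k))"
    unfolding sum_distrib_left
    by (subst sum.swap, rule sum.cong[OF refl], subst sum.swap, rule refl)
  also have "\<dots> = (\<Sum>i<n. \<Sum>j<n. if i = j then d i * d j else 0)"
    using assms by (intro sum.cong) (auto simp: orthonormal_family_def)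
  also have "\<dots> = (\<Sum>j<n. (d j)\<^sup>2)"
    by (simp add: power2_eq_square)
  finally show ?thesis .
qed

text \<open>
  Compactness of the orthogonal group. The constraint keeps the denominators positive, which makes
  the functional continuous.
\<close>

lemma orthonormal_minimizer:
  fixes M :: "nat \<Rightarrow> nat \<Rightarrow> real"
  assumes pos: "\<And>i. i < n \<Longrightarrow> 0 < M i i"
  defines "\<Phi> \<equiv> \<lambda>v. \<Sum>i<n. (M i i / (\<Sum>k<n. M i k * v i k)) ^ n"
  defines "ok \<equiv> \<lambda>v. orthonormal_family n v \<and> (\<forall>i<n. M i i / 2 \<le> (\<Sum>k<n. M i k * v i k))"
  shows "\<exists>v. ok v \<and> (\<forall>w. ok w \<longrightarrow> \<Phi> v \<le> \<Phi> w)"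
proof -
  define B where "B p = (if fst p < n \<and> snd p < n then {-1..1} else {0::real})" for p :: "nat \<times> nat"
  define K where "K = {v \<in> PiE UNIV B. ok (\<lambda>i k. v (i, k))}"
  have coord: "continuous_on S (\<lambda>v::nat \<times> nat \<Rightarrow> real. v p)" for p S
    by (rule continuous_on_product_then_coordinatewise) simp
  have "compactin (product_topology (\<lambda>_. euclidean) UNIV) (PiE UNIV B)"
    by (subst compactin_PiE) (auto simp: B_def)
  then have comp: "compact (PiE UNIV B)"
    by (simp add: euclidean_product_topology)
  have "closed {v :: nat \<times> nat \<Rightarrow> real. ok (\<lambda>i k. v (i, k))}"
  proof -
    have "{v :: nat \<times> nat \<Rightarrow> real. ok (\<lambda>i k. v (i, k))} =
      (\<Inter>i\<in>{..<n}. \<Inter>j\<in>{..<n}. {v. (\<Sum>k<n. v (i, k) * v (j, k)) = (if i = j then 1 else 0)})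
       \<inter> (\<Inter>i\<in>{..<n}. {v. M i i / 2 \<le> (\<Sum>k<n. M i k * v (i, k))})"
      by (auto simp: ok_def orthonormal_family_def)
    also have "closed \<dots>"
      by (intro closed_Int closed_INT ballI closed_Collect_eq closed_Collect_le continuous_intros coord)
    finally show ?thesis .
  qed
  with comp have "compact K"
    unfolding K_def Collect_conj_eq Collect_mem_eq by (rule compact_Int_closed)
  \<comment> \<open>Only the entries below \<open>n\<close> matter; setting the others to \<open>0\<close> makes the set of families compact.\<close>
  have trunc: "\<exists>v\<in>K. \<Phi> (\<lambda>i k. v (i, k)) = \<Phi> w" if "ok w" for w
  proof
    let ?v = "\<lambda>(i, k). if i < n \<and> k < n then w i k else 0"
    show "\<Phi> (\<lambda>i k. ?v (i, k)) = \<Phi> w"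
      unfolding \<Phi>_def by (intro sum.cong refl) simp
    have "ok (\<lambda>i k. ?v (i, k))"
      using that unfolding ok_def orthonormal_family_def by simp
    moreover have "?v \<in> PiE UNIV B"
      using that orthonormal_family_entry_le[of n w]
      by (auto simp: B_def ok_def abs_le_iff)
    ultimately show "?v \<in> K" by (simp add: K_def)
  qed
  have "ok (\<lambda>i k. if i = k then 1 else 0)"
    using pos by (auto simp: ok_def orthonormal_family_def if_distrib[of "(*) _"] less_imp_le cong: if_cong)
  then have "K \<noteq> {}" using trunc by blast
  have pos': "(\<Sum>k<n. M i k * v (i, k)) \<noteq> 0" if "v \<in> K" "i < n" for v i
    using that pos[of i] by (auto simp: K_def ok_def dest!: spec[of _ i])
  have "continuous_on K (\<lambda>v. \<Phi> (\<lambda>i k. v (i, k)))"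
    unfolding \<Phi>_def
    by (intro continuous_intros coord) (auto dest: pos')
  then obtain v where v: "v \<in> K" and v_min: "\<forall>w\<in>K. \<Phi> (\<lambda>i k. v (i, k)) \<le> \<Phi> (\<lambda>i k. w (i, k))"
    using continuous_attains_inf[OF \<open>compact K\<close> \<open>K \<noteq> {}\<close>] by blast
  have "\<Phi> (\<lambda>i k. v (i, k)) \<le> \<Phi> w" if w: "ok w" for w
  proof -
    obtain w' where "w' \<in> K" "\<Phi> (\<lambda>i k. w' (i, k)) = \<Phi> w"
      using trunc[OF w] by (elim bexE)
    then show ?thesis using v_min by (metis (no_types, lifting))
  qed
  moreover have "ok (\<lambda>i k. v (i, k))" using v by (simp add: K_def)
  ultimately show ?thesis by (intro exI conjI allI impI)
qed

text \<open>
  Writing \<open>V\<close> for the orthogonal matrix with columns \<open>v j\<close> and \<open>N = M V\<close>, the claim is that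
  \<open>N i i \<ge> M i i / 2\<close> and that \<open>\<theta> i * N i j\<close> is symmetric. Take \<open>V\<close> minimising
  \<open>\<Phi> = \<Sum>i<n. (M i i / N i i) ^ n\<close>. The large exponent makes this a substitute for maximising the least
  ratio \<open>N i i / M i i\<close>, which would not be a smooth function of \<open>V\<close>. Since rotations in a coordinate
  plane do not decrease \<open>\<Phi>\<close> at the minimum, its derivative along them vanishes.
\<close>

lemma symmetrize_rotation:
  fixes M :: "nat \<Rightarrow> nat \<Rightarrow> real"
  assumes pos: "\<And>i. i < n \<Longrightarrow> 0 < M i i"
  shows "\<exists>v \<theta>. orthonormal_family n v \<and> (\<forall>i<n. 0 < \<theta> i) \<and>
    (\<forall>i<n. M i i / 2 \<le> (\<Sum>k<n. M i k * v i k)) \<and>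
    (\<forall>i<n. \<forall>j<n. \<theta> i * (\<Sum>k<n. M i k * v j k) = \<theta> j * (\<Sum>k<n. M j k * v i k))"
proof -
  define \<Phi> where "\<Phi> v = (\<Sum>i<n. (M i i / (\<Sum>k<n. M i k * v i k)) ^ n)" for v
  define ok where "ok v \<longleftrightarrow> orthonormal_family n v \<and> (\<forall>i<n. M i i / 2 \<le> (\<Sum>k<n. M i k * v i k))" for v
  obtain v where v: "ok v" and v_min: "\<And>w. ok w \<Longrightarrow> \<Phi> v \<le> \<Phi> w"
    using orthonormal_minimizer[of n M] pos unfolding \<Phi>_def ok_def by blast
  define N where "N i j = (\<Sum>k<n. M i k * v j k)" for i j
  have N_ge: "M i i / 2 \<le> N i i" if "i < n" for i
    using v that by (simp add: ok_def N_def)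
  have N_pos: "0 < N i i" if "i < n" for i
    using N_ge[OF that] pos[OF that] by simp
  \<comment> \<open>The minimiser stays away from the boundary of the constraint: each summand is at most
    \<open>\<Phi> I = n < 2 ^ n\<close>. The exponent \<open>n\<close> is chosen for this step.\<close>
  have N_gt: "M i i / 2 < N i i" if i: "i < n" for i
  proof -
    have "(M i i / N i i) ^ n \<le> \<Phi> v"
      unfolding \<Phi>_def N_def using i
      by (intro member_le_sum[of i "{..<n}" "\<lambda>i. (M i i / (\<Sum>k<n. M i k * v i k)) ^ n"])
        (auto intro!: zero_le_power divide_nonneg_nonneg less_imp_le[OF pos] less_imp_le[OF N_pos[unfolded N_def]])
    also have "\<Phi> v \<le> \<Phi> (\<lambda>i k. if i = k then 1 else 0)"
      using pos by (intro v_min)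
       (auto simp: ok_def orthonormal_family_def if_distrib[of "(*) _"] less_imp_le cong: if_cong)
    also have "\<dots> = real n"
      using pos unfolding \<Phi>_def by (simp add: if_distrib[of "(*) _"] less_imp_neq[symmetric] cong: if_cong) 
    also have "\<dots> < 2 ^ n" by (rule of_nat_less_two_power)
    finally have "M i i / N i i < 2" by (rule power_less_imp_less_base) simp
    then show ?thesis using N_pos[OF i] by (simp add: field_simps)
  qed
  \<comment> \<open>Up to the factor \<open>- n\<close>, this is the derivative of the \<open>i\<close>-th summand of \<open>\<Phi>\<close> with respect to
    \<open>N i i\<close>; the vanishing derivative along a rotation is therefore the asserted symmetry.\<close>
  define \<theta> where "\<theta> i = M i i ^ n / N i i ^ Suc n" for i
  have sym: "\<theta> i * N i j = \<theta> j * N j i" if ij: "i < n" "j < n" "i \<noteq> j" for i j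
  proof -
    define f where "f t = N i i * cos t + N i j * sin t" for t
    define g where "g t = N j j * cos t - N j i * sin t" for t
    define h where "h t = (M i i / f t) ^ n + (M j j / g t) ^ n" for t
    have rot: "(\<Sum>k<n. M p k * rotate_pair i j t v p k) =
       (if p = i then f t else if p = j then g t else N p p)" for p t
      using ij by (auto simp: rotate_pair_def f_def g_def N_def algebra_simps sum.distrib sum_subtractf
          sum_distrib_left)
    have \<Phi>_rot: "\<Phi> (rotate_pair i j t v) = h t + (\<Sum>p\<in>{..<n}-{i}-{j}. (M p p / N p p) ^ n)" for t
    proof -
      have "\<Phi> (rotate_pair i j t v) =
          (\<Sum>p<n. (M p p / (if p = i then f t else if p = j then g t else N p p)) ^ n)"
        unfolding \<Phi>_def rot ..
      also have "\<dots> = (M i i / f t) ^ n + ((M j j / g t) ^ n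
         + (\<Sum>p\<in>{..<n}-{i}-{j}. (M p p / (if p = i then f t else if p = j then g t else N p p)) ^ n))"
        using ij by (subst sum.remove[of _ i], simp, simp, subst sum.remove[of _ j]) auto
      also have "(\<Sum>p\<in>{..<n}-{i}-{j}. (M p p / (if p = i then f t else if p = j then g t else N p p)) ^ n)
        = (\<Sum>p\<in>{..<n}-{i}-{j}. (M p p / N p p) ^ n)"
        by (intro sum.cong) auto
      finally show ?thesis by (simp add: h_def)
    qed
    have cont: "(f \<longlongrightarrow> N i i) (at 0)" "(g \<longlongrightarrow> N j j) (at 0)"
      unfolding f_def g_def by (auto intro!: tendsto_eq_intros)
    have "eventually (\<lambda>t. M i i / 2 < f t \<and> M j j / 2 < g t) (at 0)"
      using order_tendstoD(1)[OF cont(1) N_gt] order_tendstoD(1)[OF cont(2) N_gt] ij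
      by (simp add: eventually_conj_iff)
    then have "eventually (\<lambda>t. h 0 \<le> h t) (at 0)"
    proof eventually_elim
      case (elim t)
      then have "ok (rotate_pair i j t v)"
        using v ij N_ge unfolding ok_def rot by (auto intro!: orthonormal_family_rotate_pair)
      then have "\<Phi> v \<le> \<Phi> (rotate_pair i j t v)" by (rule v_min)
      moreover have "rotate_pair i j 0 v = v" by (auto simp: rotate_pair_def fun_eq_iff)
      ultimately show ?case using \<Phi>_rot[of 0] \<Phi>_rot[of t] by simp
    qed
    then obtain \<delta> where \<delta>: "\<delta> > 0" "\<And>t. t \<noteq> 0 \<Longrightarrow> dist t 0 < \<delta> \<Longrightarrow> h 0 \<le> h t"
      unfolding eventually_at by auto
    have min: "\<forall>t. \<bar>0 - t\<bar> < \<delta> \<longrightarrow> h 0 \<le> h t"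
      using \<delta>(2) by (auto simp: dist_real_def) (metis order_refl)
    have "((\<lambda>t. (M i i / f t) ^ n + (M j j / g t) ^ n) has_real_derivative
      (real n * (M j j ^ n / N j j ^ Suc n * N j i) - real n * (M i i ^ n / N i i ^ Suc n * N i j))) (at 0)"
    proof -
      have n: "n = Suc (n - 1)" using ij by simp
      have dc: "((\<lambda>t. (c / F t) ^ n) has_real_derivative - (real n * (c ^ n / F 0 ^ Suc n * F'))) (at 0)"
        if "(F has_real_derivative F') (at 0)" "F 0 \<noteq> 0" for c F F'
      proof -
        have "((\<lambda>t. (c / F t) ^ n) has_real_derivative
          real n * (c / F 0) ^ (n - 1) * (- (c * F') / (F 0 * F 0))) (at 0)"
          using that by (auto intro!: derivative_eq_intros)
        also have "real n * (c / F 0) ^ (n - 1) * (- (c * F') / (F 0 * F 0)) =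
           - (real n * (c ^ n / F 0 ^ Suc n * F'))"
          using that(2) by (subst (3 4) n) (simp add: power_divide field_simps)
        finally show ?thesis .
      qed
      have f': "(f has_real_derivative N i j) (at 0)" and g': "(g has_real_derivative - N j i) (at 0)"
        unfolding f_def g_def by (auto intro!: derivative_eq_intros)
      have "f 0 = N i i" "g 0 = N j j" by (auto simp: f_def g_def)
      then show ?thesis
        using DERIV_add[OF dc[OF f', of "M i i"] dc[OF g', of "M j j"]] N_pos[OF ij(1)] N_pos[OF ij(2)]
        by (simp add: algebra_simps)
    qed
    then have "(h has_real_derivative real n * (\<theta> j * N j i) - real n * (\<theta> i * N i j)) (at 0)"
      unfolding h_def \<theta>_def .
    from DERIV_local_min[OF this \<delta>(1) min] show ?thesis using ij by simp
  qed
  have "\<theta> i * N i j = \<theta> j * N j i" if "i < n" "j < n" for i j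
    using sym that by (cases "i = j") auto
  moreover have "0 < \<theta> i" if "i < n" for i
    using pos[OF that] N_pos[OF that] by (simp add: \<theta>_def)
  ultimately show ?thesis
    using v unfolding ok_def N_def by blast
qed

text \<open>
  Ball's theorem on matrices with unit diagonal, up to a factor \<open>2\<close>. Apply Bang's lemma to the symmetric
  matrix \<open>\<Theta> H W V\<close> with \<open>W = diag (sqrt w)\<close>, and let \<open>l = W V d\<close> for the resulting vector \<open>d\<close> with
  entries \<open>\<plusminus> sqrt (w i)\<close>. The factors \<open>\<theta> i\<close> cancel, and as \<open>V\<close> is an isometry, \<open>l\<close> is \<open>W\<close> times
  a vector of Euclidean norm \<open>sqrt (sum w {..<n})\<close>. Bounding the partial sums of \<open>\<bar>l\<bar>\<close>, and not only the whole sum, is what allows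
  the passage to infinitely many planks.
\<close>

lemma finite_plank:
  fixes H :: "nat \<Rightarrow> nat \<Rightarrow> real" and w :: "nat \<Rightarrow> real"
  assumes H: "\<And>i. i < n \<Longrightarrow> H i i = 1" and w: "\<And>i. i < n \<Longrightarrow> 0 < w i"
  shows "\<exists>l. (\<forall>i<n. w i / 2 \<le> \<bar>\<Sum>k<n. H i k * l k\<bar>) \<and>
     (\<forall>J\<subseteq>{..<n}. (\<Sum>k\<in>J. \<bar>l k\<bar>) \<le> sqrt (sum w J) * sqrt (sum w {..<n}))"
proof -
  \<comment> \<open>Half of each weight goes into the matrix and half into the sign vector, so that
    Cauchy--Schwarz recovers sums of \<open>w\<close> at the end.\<close>
  define e where "e i = sqrt (w i)" for i
  have e: "0 < e i" "e i * e i = w i" "(e i)\<^sup>2 = w i" if "i < n" for i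
    using w[OF that] by (auto simp: e_def)
  define M where "M i k = H i k * e k" for i k
  have "0 < M i i" if "i < n" for i
    using H e that by (simp add: M_def)
  from symmetrize_rotation[of n M, OF this] obtain v \<theta> where
    v: "orthonormal_family n v" and \<theta>: "\<And>i. i < n \<Longrightarrow> 0 < \<theta> i"
    and diag: "\<And>i. i < n \<Longrightarrow> M i i / 2 \<le> (\<Sum>k<n. M i k * v i k)"
    and sym: "\<And>i j. i < n \<Longrightarrow> j < n \<Longrightarrow>
       \<theta> i * (\<Sum>k<n. M i k * v j k) = \<theta> j * (\<Sum>k<n. M j k * v i k)"
    by blast
  obtain d where d: "\<And>i. i < n \<Longrightarrow> \<bar>d i\<bar> = e i"
    and bang: "\<And>i. i < n \<Longrightarrow> \<theta> i * (\<Sum>k<n. M i k * v i k) * e i \<le>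
       \<bar>\<Sum>j<n. \<theta> i * (\<Sum>k<n. M i k * v j k) * d j\<bar>"
    using bang_sign_choice[of n "\<lambda>i j. \<theta> i * (\<Sum>k<n. M i k * v j k)" e, OF sym e(1)] by blast
  define y where "y k = (\<Sum>j<n. v j k * d j)" for k
  define l where "l k = e k * y k" for k
  have "w i / 2 \<le> \<bar>\<Sum>k<n. H i k * l k\<bar>" if i: "i < n" for i
  proof -
    have "(\<Sum>j<n. \<theta> i * (\<Sum>k<n. M i k * v j k) * d j) = \<theta> i * (\<Sum>j<n. \<Sum>k<n. M i k * v j k * d j)"
      by (simp add: sum_distrib_left sum_distrib_right mult_ac)
    also have "\<dots> = \<theta> i * (\<Sum>k<n. H i k * l k)"
      by (subst sum.swap) (simp add: l_def y_def M_def sum_distrib_left mult_ac)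
    finally have "\<theta> i * ((\<Sum>k<n. M i k * v i k) * e i) \<le> \<theta> i * \<bar>\<Sum>k<n. H i k * l k\<bar>"
      using bang[OF i] \<theta>[OF i] by (simp add: abs_mult mult_ac)
    then have "(\<Sum>k<n. M i k * v i k) * e i \<le> \<bar>\<Sum>k<n. H i k * l k\<bar>"
      using \<theta>[OF i] by simp
    moreover have "w i / 2 \<le> (\<Sum>k<n. M i k * v i k) * e i"
      using mult_right_mono[OF diag[OF i] less_imp_le[OF e(1)[OF i]]] e[OF i] H[OF i]
      by (simp add: M_def)
    ultimately show ?thesis by simp
  qed
  moreover have "(\<Sum>k\<in>J. \<bar>l k\<bar>) \<le> sqrt (sum w J) * sqrt (sum w {..<n})" if J: "J \<subseteq> {..<n}" for J
  proof -
    have "(\<Sum>k\<in>J. \<bar>l k\<bar>) = (\<Sum>k\<in>J. \<bar>e k\<bar> * \<bar>y k\<bar>)" by (simp add: l_def abs_mult)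
    also have "\<dots> \<le> L2_set e J * L2_set y J" by (rule L2_set_mult_ineq)
    also have "\<dots> \<le> L2_set e J * L2_set y {..<n}"
      using J by (intro mult_left_mono) (auto simp: L2_set_def intro!: sum_mono2 sum_nonneg)
    also have "L2_set e J = sqrt (sum w J)"
      using J e(3) unfolding L2_set_def by (intro arg_cong[of _ _ sqrt] sum.cong) auto
    also have "L2_set y {..<n} = sqrt (sum w {..<n})"
    proof -
      have "(\<Sum>k<n. (y k)\<^sup>2) = (\<Sum>j<n. (d j)\<^sup>2)"
        unfolding y_def by (rule orthonormal_family_isometric[OF v])
      also have "\<dots> = sum w {..<n}"
      proof (intro sum.cong refl)
        show "(d j)\<^sup>2 = w j" if "j \<in> {..<n}" for j
          using d[of j] e(3)[of j] that power2_abs[of "d j"] by simp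
      qed
      finally show ?thesis by (simp add: L2_set_def)
    qed
    finally show ?thesis .
  qed
  ultimately show ?thesis by blast
qed


section \<open>Free filters and normed spaces with an explicit carrier\<close>

lemma free_filter_le_sequentially:
  assumes "free_filter F" shows "F \<le> sequentially"
proof (rule filter_leI)
  fix P assume "eventually P sequentially"
  then obtain n where "\<And>k. n \<le> k \<Longrightarrow> P k" by (auto simp: eventually_sequentially)
  then have "- Collect P \<subseteq> {..<n}" by (auto simp: not_le[symmetric])
  then have "finite (- Collect P)" by (rule finite_subset) simp
  then have "eventually (\<lambda>k. k \<in> Collect P) F" using assms unfolding free_filter_def by blast
  then show "eventually P F" by simp
qed

context normed_space_on begin

lemma limitin_norm_topology:
  "limitin (norm_topology X N) f x F \<longleftrightarrow>
     x \<in> X \<and> (\<forall>\<epsilon>>0. eventually (\<lambda>n. f n \<in> X \<and> N (f n - x) < \<epsilon>) F)"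
proof -
  have "(f n \<in> X \<and> norm_dist X N (f n) x < \<epsilon>) = (f n \<in> X \<and> N (f n - x) < \<epsilon>)" if "x \<in> X" for n \<epsilon>
    using that by (simp add: norm_dist_def)
  then show ?thesis
    unfolding norm_topology_def limitin_metric by (simp cong: conj_cong)
qed

lemma filter_expansion_eventually:
  assumes "filter_expansion F X N u x c" "\<epsilon> > 0"
  shows "eventually (\<lambda>n. N ((\<Sum>k\<le>n. c k *\<^sub>R u k) - x) < \<epsilon>) F"
proof -
  have "eventually (\<lambda>n. (\<Sum>k\<le>n. c k *\<^sub>R u k) \<in> X \<and> N ((\<Sum>k\<le>n. c k *\<^sub>R u k) - x) < \<epsilon>) F"
    using assms unfolding filter_expansion_def limitin_norm_topology by blast
  then show ?thesis by (rule eventually_mono) simp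
qed

lemma sum_in_carrier: "(\<And>k. k \<in> K \<Longrightarrow> f k \<in> X) \<Longrightarrow> sum f K \<in> X"
  by (rule subspace_sum[OF subspace_carrier])

lemma scale_in_carrier: "x \<in> X \<Longrightarrow> r *\<^sub>R x \<in> X"
  by (rule subspace_scale[OF subspace_carrier])

lemma minus_in_carrier: "x \<in> X \<Longrightarrow> y \<in> X \<Longrightarrow> x - y \<in> X"
  by (rule subspace_diff[OF subspace_carrier])

lemma add_in_carrier: "x \<in> X \<Longrightarrow> y \<in> X \<Longrightarrow> x + y \<in> X"
  by (rule subspace_add[OF subspace_carrier])

lemma norm_minus_commute: "x \<in> X \<Longrightarrow> y \<in> X \<Longrightarrow> N (x - y) = N (y - x)"
  using norm_scale[of "x - y" "-1"] minus_in_carrier[of x y] by simp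

lemma norm_triangle_diff: "x \<in> X \<Longrightarrow> y \<in> X \<Longrightarrow> N x \<le> N (x - y) + N y"
  using norm_triangle[of "x - y" y] minus_in_carrier[of x y] by simp

lemma norm_sum_le: "(\<And>k. k \<in> K \<Longrightarrow> f k \<in> X) \<Longrightarrow> N (sum f K) \<le> (\<Sum>k\<in>K. N (f k))"
proof (induction K rule: infinite_finite_induct)
  case (insert k K)
  then have "N (f k + sum f K) \<le> N (f k) + N (sum f K)"
    by (intro norm_triangle sum_in_carrier) auto
  with insert show ?case by fastforce
qed (use norm_eq_0[of 0] subspace_0[OF subspace_carrier] in auto)

end


section \<open>Norming functionals on finitely generated subspaces\<close>

lemma linear_vanishing_on_span:
  fixes b :: "'v::real_vector"
  assumes "b \<notin> span S"
  shows "\<exists>h :: 'v \<Rightarrow> real. linear h \<and> (\<forall>v\<in>span S. h v = 0) \<and> h b = 1"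
proof -
  obtain T where T: "T \<subseteq> span S" "independent T" "span S \<subseteq> span T"
    using maximal_independent_subset[of "span S"] by blast
  have "span T = span S"
    using T(1,3) by (metis span_mono span_span subset_antisym)
  then have ind: "independent (insert b T)" and b: "b \<notin> T"
    using T(2) assms by (auto simp: independent_insert span_base)
  obtain h :: "'v \<Rightarrow> real" where h: "linear h" "\<And>x. x \<in> insert b T \<Longrightarrow> h x = (if x = b then 1 else 0)"
    using linear_independent_extend[OF ind, of "\<lambda>x. if x = b then 1 else 0"] by blast
  have "h v = 0" if "v \<in> span S" for v
    using linear_eq_0_on_span[OF h(1), of T v] h(2) b that \<open>span T = span S\<close> by fastforce
  with h show ?thesis by auto
qed

context normed_space_on begin

text \<open>
  The one-dimensional step of the Hahn--Banach theorem. The functionals are linear on the whole ambient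
  space, and only the domination is confined to the span; this avoids partial functions.
\<close>

lemma dominated_extension_step:
  fixes f :: "'v \<Rightarrow> real"
  assumes f: "linear f" "\<And>v. v \<in> span S \<Longrightarrow> f v \<le> N v" and S: "S \<subseteq> X" and b: "b \<in> X"
  shows "\<exists>g. linear g \<and> (\<forall>v\<in>span S. g v = f v) \<and> (\<forall>v\<in>span (insert b S). g v \<le> N v)"
proof (cases "b \<in> span S")
  case True
  then have "span (insert b S) = span S" by (rule span_redundant)
  with f show ?thesis by auto
next
  case False
  have SX: "span S \<subseteq> X" using S subspace_carrier by (rule span_minimal)
  obtain h :: "'v \<Rightarrow> real" where h: "linear h" "\<And>v. v \<in> span S \<Longrightarrow> h v = 0" "h b = 1"
    using linear_vanishing_on_span[OF False] by blast
  \<comment> \<open>The value at \<open>b\<close> has to lie above every left-hand side and below every right-hand side.\<close>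
  have sandwich: "f v - N (v - b) \<le> N (v' + b) - f v'" if "v \<in> span S" "v' \<in> span S" for v v'
  proof -
    have "f v + f v' \<le> N (v + v')"
      using f(2)[OF span_add[OF that]] by (simp add: linear_add[OF f(1)])
    also have "\<dots> \<le> N (v - b) + N (v' + b)"
    proof -
      have "v \<in> X" "v' \<in> X" using that SX by auto
      then show ?thesis
        using norm_triangle[OF minus_in_carrier[OF _ b] add_in_carrier[OF _ b], of v v'] by simp
    qed
    finally show ?thesis by simp
  qed
  define \<alpha> where "\<alpha> = (SUP v\<in>span S. f v - N (v - b))"
  have bdd: "bdd_above ((\<lambda>v. f v - N (v - b)) ` span S)"
    using sandwich[OF _ span_0] by (intro bdd_aboveI2)
  have lo: "f v - N (v - b) \<le> \<alpha>" if "v \<in> span S" for v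
    unfolding \<alpha>_def using that bdd by (rule cSUP_upper)
  have hi: "\<alpha> \<le> N (v + b) - f v" if "v \<in> span S" for v
    unfolding \<alpha>_def using that sandwich span_0 by (intro cSUP_least) auto
  define g where "g v = f v + (\<alpha> - f b) * h v" for v
  have "linear g"
    unfolding g_def using f(1) h(1)
    by (auto simp: linear_iff algebra_simps)
  moreover have "\<forall>v\<in>span S. g v = f v" by (simp add: g_def h)
  moreover have "g z \<le> N z" if z_span: "z \<in> span (insert b S)" for z
  proof -
    obtain t where "z - t *\<^sub>R b \<in> span S" using z_span by (auto simp: span_breakdown_eq)
    moreover define v where "v = z - t *\<^sub>R b"
    ultimately have v: "v \<in> span S" and z: "z = v + t *\<^sub>R b" by auto
    have gz: "g z = f v + t * \<alpha>"
      using h v f(1) unfolding g_def z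
      by (simp add: linear_add linear_cmul algebra_simps)
    consider "t = 0" | "t > 0" | "t < 0" by linarith
    then show ?thesis
    proof cases
      case 1
      then show ?thesis using f(2)[OF v] gz z by simp
    next
      case 2
      have v': "inverse t *\<^sub>R v \<in> span S" using v by (rule span_scale)
      have "t * \<alpha> \<le> t * (N (inverse t *\<^sub>R v + b) - f (inverse t *\<^sub>R v))"
        using 2 hi[OF v'] by (intro mult_left_mono) auto
      also have "\<dots> = N (t *\<^sub>R (inverse t *\<^sub>R v + b)) - f v"
        using 2 f(1) v' SX b
        by (subst norm_scale) (auto simp: add_in_carrier linear_cmul algebra_simps)
      also have "t *\<^sub>R (inverse t *\<^sub>R v + b) = z"
        using 2 by (simp add: z scaleR_add_right)
      finally show ?thesis using gz by simp
    next
      case 3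
      have v': "inverse (- t) *\<^sub>R v \<in> span S" using v by (rule span_scale)
      have "(- t) * (f (inverse (- t) *\<^sub>R v) - N (inverse (- t) *\<^sub>R v - b)) \<le> (- t) * \<alpha>"
        using 3 lo[OF v'] by (intro mult_left_mono) auto
      moreover have "(- t) * (f (inverse (- t) *\<^sub>R v) - N (inverse (- t) *\<^sub>R v - b)) =
          f v - N ((- t) *\<^sub>R (inverse (- t) *\<^sub>R v - b))"
      proof -
        have "N ((- t) *\<^sub>R (inverse (- t) *\<^sub>R v - b)) = (- t) * N (inverse (- t) *\<^sub>R v - b)"
          using 3 v' SX b norm_scale[of "inverse (- t) *\<^sub>R v - b" "- t"]
          by (auto simp: minus_in_carrier)
        moreover have "(- t) * f (inverse (- t) *\<^sub>R v) = f v"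
          using 3 by (simp only: linear_cmul[OF f(1)]) simp
        ultimately show ?thesis by (simp only: right_diff_distrib)
      qed
      moreover have "(- t) *\<^sub>R (inverse (- t) *\<^sub>R v - b) = z"
        using 3 by (simp add: z scaleR_diff_right)
      ultimately show ?thesis using gz by simp
    qed
  qed
  ultimately show ?thesis by blast
qed

text \<open>
  The partial sums operators have finite rank, so finitely many extension steps suffice.
\<close>

lemma norming_functional:
  assumes y: "y \<in> X" and B: "finite B" "B \<subseteq> X"
  shows "\<exists>f :: 'v \<Rightarrow> real. linear f \<and> f y = N y \<and> (\<forall>z\<in>span (insert y B). f z \<le> N z)"
  using B
proof (induction B rule: finite_induct)
  case empty
  show ?case
  proof (cases "y = 0")
    case True
    then have "linear (\<lambda>_::'v. 0::real)" "N y = 0" "\<forall>z\<in>span {y}. 0 \<le> N z"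
      using y norm_eq_0[of 0] by (auto simp: linear_iff)
    then show ?thesis by fastforce
  next
    case False
    then have "y \<notin> span {}" by simp
    then obtain h :: "'v \<Rightarrow> real" where h: "linear h" "h y = 1"
      using linear_vanishing_on_span by blast
    have "N y * h z \<le> N z" if z_span: "z \<in> span {y}" for z
    proof -
      obtain t where z: "z = t *\<^sub>R y" using z_span by (auto simp: span_singleton)
      have "t * N y \<le> \<bar>t\<bar> * N y" using norm_nonneg[OF y] by (intro mult_right_mono) auto
      then show ?thesis using h norm_scale[OF y] by (simp add: z linear_cmul mult.commute)
    qed
    moreover have "linear (\<lambda>z. N y * h z)" using h(1) by (auto simp: linear_iff algebra_simps)
    ultimately show ?thesis using h(2) by (intro exI[of _ "\<lambda>z. N y * h z"]) auto
  qed
next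
  case (insert b B)
  then obtain f :: "'v \<Rightarrow> real" where f: "linear f" "f y = N y" "\<And>z. z \<in> span (insert y B) \<Longrightarrow> f z \<le> N z"
    by auto
  obtain g where "linear g" "\<forall>v\<in>span (insert y B). g v = f v"
    "\<forall>v\<in>span (insert b (insert y B)). g v \<le> N v"
    using dominated_extension_step[of f "insert y B" b] f(1,3) y insert.prems by auto
  moreover have "insert b (insert y B) = insert y (insert b B)" by auto
  ultimately show ?case using f(2) by (metis insertI1 span_base)
qed

end


section \<open>A plank theorem for Banach spaces\<close>

lemma coordinatewise_convergent_subsequence:
  fixes l :: "nat \<Rightarrow> nat \<Rightarrow> real"
  assumes "\<And>n k. \<bar>l n k\<bar> \<le> C"
  shows "\<exists>r L. strict_mono r \<and> (\<forall>k. (\<lambda>n. l (r n) k) \<longlonglongrightarrow> L k)"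
proof -
  have "compactin (product_topology (\<lambda>_. euclidean) UNIV) (PiE (UNIV :: nat set) (\<lambda>_. {-C..C}))"
    by (subst compactin_PiE) auto
  then have "compact (PiE (UNIV :: nat set) (\<lambda>_. {-C..C}))"
    by (simp add: euclidean_product_topology)
  then have "seq_compact (PiE (UNIV :: nat set) (\<lambda>_. {-C..C}))"
    by (simp add: compact_eq_seq_compact_metric)
  moreover have "l n \<in> PiE UNIV (\<lambda>_. {-C..C})" for n
    using assms by (auto simp: abs_le_iff) (metis minus_le_iff)
  ultimately obtain L r where r: "strict_mono r" "(l \<circ> r) \<longlonglongrightarrow> L"
    unfolding seq_compact_def by metis
  have "(\<lambda>n. l (r n) k) \<longlonglongrightarrow> L k" for k
  proof -
    have "continuous_on UNIV (\<lambda>f :: nat \<Rightarrow> real. f k)"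
      by (rule continuous_on_product_then_coordinatewise) simp
    from continuous_on_tendsto_compose[OF this r(2)] show ?thesis by (simp add: o_def)
  qed
  with r(1) show ?thesis by blast
qed

context banach_space_on begin

text \<open>
  Coefficients that are bounded and have uniformly small tails form a relatively compact set, as
  a diagonal argument shows, and the map from coefficients to combinations is continuous on it.
\<close>

lemma combinations_convergent_subsequence:
  assumes x: "\<And>k. x k \<in> X" "\<And>k. N (x k) \<le> 1"
    and bound: "\<And>n k. \<bar>l n k\<bar> \<le> C" and fin: "\<And>n k. n \<le> k \<Longrightarrow> l n k = 0"
    and tail: "\<And>n J. (\<Sum>k\<in>{J..<n}. \<bar>l n k\<bar>) \<le> T J" and T: "T \<longlonglongrightarrow> 0"
  shows "\<exists>r z. strict_mono (r :: nat \<Rightarrow> nat) \<and>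
    limitin (norm_topology X N) (\<lambda>n. \<Sum>k<r n. l (r n) k *\<^sub>R x k) z sequentially"
proof -
  obtain r L where r: "strict_mono (r :: nat \<Rightarrow> nat)" and L: "\<And>k. (\<lambda>n. l (r n) k) \<longlonglongrightarrow> L k"
    using coordinatewise_convergent_subsequence[of l C] bound by blast
  define z where "z n = (\<Sum>k<r n. l (r n) k *\<^sub>R x k)" for n
  have z_X: "z n \<in> X" for n
    unfolding z_def by (intro sum_in_carrier scale_in_carrier x)
  have tail': "(\<Sum>k\<in>{J..<K}. \<bar>l n k\<bar>) \<le> T J" if "n \<le> K" for n J K
  proof -
    have "(\<Sum>k\<in>{J..<K}. \<bar>l n k\<bar>) = (\<Sum>k\<in>{J..<n}. \<bar>l n k\<bar>)"
      using that fin by (intro sum.mono_neutral_right) auto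
    then show ?thesis using tail by simp
  qed
  \<comment> \<open>Finitely many coefficients converge, and the others contribute at most two tails.\<close>
  have diff: "N (z n - z m) \<le> (\<Sum>k<J. \<bar>l (r n) k - l (r m) k\<bar>) + 2 * T J" for n m J
  proof -
    define K where "K = r n + r m + J"
    have z_K: "z p = (\<Sum>k<K. l (r p) k *\<^sub>R x k)" if "r p \<le> K" for p
      unfolding z_def using that fin by (intro sum.mono_neutral_left) auto
    have "z n - z m = (\<Sum>k<K. (l (r n) k - l (r m) k) *\<^sub>R x k)"
      using z_K[of n] z_K[of m] by (simp add: K_def sum_subtractf scaleR_diff_left)
    then have "N (z n - z m) \<le> (\<Sum>k<K. N ((l (r n) k - l (r m) k) *\<^sub>R x k))"
      by (auto intro!: norm_sum_le scale_in_carrier x)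
    also have "\<dots> \<le> (\<Sum>k<K. \<bar>l (r n) k - l (r m) k\<bar>)"
      using x by (intro sum_mono) (simp add: norm_scale mult_left_le)
    also have "\<dots> = (\<Sum>k<J. \<bar>l (r n) k - l (r m) k\<bar>) + (\<Sum>k\<in>{J..<K}. \<bar>l (r n) k - l (r m) k\<bar>)"
      using sum.atLeastLessThan_concat[of 0 J K "\<lambda>k. \<bar>l (r n) k - l (r m) k\<bar>"]
      by (simp add: K_def atLeast0LessThan)
    also have "(\<Sum>k\<in>{J..<K}. \<bar>l (r n) k - l (r m) k\<bar>) \<le>
        (\<Sum>k\<in>{J..<K}. \<bar>l (r n) k\<bar> + \<bar>l (r m) k\<bar>)"
      by (intro sum_mono) auto
    also have "\<dots> \<le> 2 * T J"
      using tail'[of "r n" K J] tail'[of "r m" K J] by (simp add: K_def sum.distrib)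
    finally show ?thesis by simp
  qed
  have "MCauchy z"
    unfolding MCauchy_def
  proof (intro conjI allI impI)
    show "range z \<subseteq> X" using z_X by auto
    fix \<epsilon> :: real assume "\<epsilon> > 0"
    then have "eventually (\<lambda>J. T J < \<epsilon> / 4) sequentially" using T by (intro order_tendstoD) auto
    then obtain J where J: "T J < \<epsilon> / 4" by (auto simp: eventually_sequentially)
    have "(\<lambda>n. \<Sum>k<J. \<bar>l (r n) k - L k\<bar>) \<longlonglongrightarrow> (\<Sum>k<J. \<bar>L k - L k\<bar>)"
      by (intro tendsto_intros L)
    then have "eventually (\<lambda>n. (\<Sum>k<J. \<bar>l (r n) k - L k\<bar>) < \<epsilon> / 4) sequentially"
      using \<open>\<epsilon> > 0\<close> by (intro order_tendstoD) auto
    then obtain M where M: "\<And>n. M \<le> n \<Longrightarrow> (\<Sum>k<J. \<bar>l (r n) k - L k\<bar>) < \<epsilon> / 4"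
      by (auto simp: eventually_sequentially)
    have "norm_dist X N (z n) (z m) < \<epsilon>" if "M \<le> n" "M \<le> m" for n m
    proof -
      have "(\<Sum>k<J. \<bar>l (r n) k - l (r m) k\<bar>) \<le> (\<Sum>k<J. \<bar>l (r n) k - L k\<bar> + \<bar>l (r m) k - L k\<bar>)"
        by (intro sum_mono) auto
      then show ?thesis
        using diff[of n m J] M[OF that(1)] M[OF that(2)] J z_X
        by (simp add: norm_dist_def sum.distrib)
    qed
    then show "\<exists>M. \<forall>n n'. M \<le> n \<longrightarrow> M \<le> n' \<longrightarrow> norm_dist X N (z n) (z n') < \<epsilon>" by blast
  qed
  then obtain z0 where "limitin mtopology z z0 sequentially"
    using complete unfolding mcomplete_def by blast
  then show ?thesis
    using r unfolding z_def norm_topology_def by blast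
qed

text \<open>
  Ball's plank theorem for planks centred at the origin, with the constant \<open>1/2\<close> in place of \<open>1\<close>. The
  matrix version applied to \<open>\<phi> i (x k) / \<phi> i (x i)\<close> handles the first \<open>n\<close> functionals for each \<open>n\<close>, and
  the tail bound \<open>sqrt (tail of w) * sqrt (sum of w)\<close> gives a limit vector.
\<close>

theorem plank_theorem:
  fixes \<phi> :: "nat \<Rightarrow> 'a \<Rightarrow> real"
  assumes x: "\<And>k. x k \<in> X" "\<And>k. N (x k) \<le> 1"
    and add: "\<And>i y z. y \<in> X \<Longrightarrow> z \<in> X \<Longrightarrow> \<phi> i (y + z) = \<phi> i y + \<phi> i z"
    and scale: "\<And>i y t. y \<in> X \<Longrightarrow> \<phi> i (t *\<^sub>R y) = t * \<phi> i y"
    and cont: "\<And>i. continuous_map (norm_topology X N) euclideanreal (\<phi> i)"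
    and nz: "\<And>i. \<phi> i (x i) \<noteq> 0" and w: "\<And>i. 0 < w i" "summable w"
  shows "\<exists>z\<in>X. N z \<le> suminf w \<and> (\<forall>i. w i / 2 * \<bar>\<phi> i (x i)\<bar> \<le> \<bar>\<phi> i z\<bar>)"
proof -
  define H where "H i k = \<phi> i (x k) / \<phi> i (x i)" for i k
  have "\<exists>l. (\<forall>i<n. w i / 2 \<le> \<bar>\<Sum>k<n. H i k * l k\<bar>) \<and>
     (\<forall>J\<subseteq>{..<n}. (\<Sum>k\<in>J. \<bar>l k\<bar>) \<le> sqrt (sum w J) * sqrt (sum w {..<n}))" for n
    using nz w(1) by (intro finite_plank) (auto simp: H_def)
  then obtain l0 where l0: "\<And>n i. i < n \<Longrightarrow> w i / 2 \<le> \<bar>\<Sum>k<n. H i k * l0 n k\<bar>"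
    "\<And>n J. J \<subseteq> {..<n} \<Longrightarrow> (\<Sum>k\<in>J. \<bar>l0 n k\<bar>) \<le> sqrt (sum w J) * sqrt (sum w {..<n})"
    by metis
  have w_nonneg: "0 \<le> w i" for i using w(1)[of i] by simp
  define C where "C = suminf w"
  have C: "sum w A \<le> C" if "finite A" for A
    unfolding C_def using that w by (intro sum_le_suminf) (auto intro: less_imp_le)
  have C_nonneg: "0 \<le> C" using C[of "{}"] by simp
  have sum_l0: "(\<Sum>k\<in>J. \<bar>l0 n k\<bar>) \<le> C" if "J \<subseteq> {..<n}" for J n
  proof -
    have "finite J" using that by (rule finite_subset) simp
    then have "sqrt (sum w J) * sqrt (sum w {..<n}) \<le> sqrt C * sqrt C"
      using C C_nonneg by (intro mult_mono) (auto intro!: sum_nonneg w_nonneg)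
    then show ?thesis using l0(2)[OF that] C_nonneg by simp
  qed
  define l where "l n k = (if k < n then l0 n k else 0)" for n k
  have bound: "\<bar>l n k\<bar> \<le> C" for n k
    using sum_l0[of "{k}" n] C_nonneg by (simp add: l_def)
  define T where "T J = sqrt (\<Sum>k. w (k + J)) * sqrt C" for J
  have "(\<lambda>J. \<Sum>k. w (k + J)) \<longlonglongrightarrow> 0"
    using suminf_exist_split2[OF w(2)] .
  then have T: "T \<longlonglongrightarrow> 0"
    unfolding T_def by (auto intro!: tendsto_eq_intros)
  have tail: "(\<Sum>k\<in>{J..<n}. \<bar>l n k\<bar>) \<le> T J" for n J
  proof -
    have "(\<Sum>k\<in>{J..<n}. \<bar>l n k\<bar>) = (\<Sum>k\<in>{J..<n}. \<bar>l0 n k\<bar>)"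
      by (intro sum.cong) (auto simp: l_def)
    also have "\<dots> \<le> sqrt (sum w {J..<n}) * sqrt (sum w {..<n})"
      by (rule l0(2)) auto
    also have "\<dots> \<le> T J"
      unfolding T_def
    proof (intro mult_mono real_sqrt_le_mono)
      have "sum w {J..<n} = (\<Sum>k<n - J. w (k + J))"
        using sum.shift_bounds_nat_ivl[of w 0 J "n - J"]
        by (cases "J \<le> n") (auto simp: atLeast0LessThan)
      also have "\<dots> \<le> (\<Sum>k. w (k + J))"
        using w by (intro sum_le_suminf) (auto simp: summable_iff_shift intro: less_imp_le)
      finally show "sum w {J..<n} \<le> (\<Sum>k. w (k + J))" .
    qed (use C C_nonneg w(2) in \<open>auto intro!: sum_nonneg suminf_nonneg w_nonneg simp: summable_iff_shift\<close>)
    finally show ?thesis .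
  qed
  obtain r z where r: "strict_mono (r :: nat \<Rightarrow> nat)" and
    lim: "limitin (norm_topology X N) (\<lambda>n. \<Sum>k<r n. l (r n) k *\<^sub>R x k) z sequentially"
    using combinations_convergent_subsequence[of x l C T, OF x bound _ tail T] by (auto simp: l_def)
  define y where "y n = (\<Sum>k<r n. l (r n) k *\<^sub>R x k)" for n
  have y_X: "y n \<in> X" for n unfolding y_def by (intro sum_in_carrier scale_in_carrier x)
  have z_X: "z \<in> X" using lim unfolding limitin_norm_topology by blast
  have N_y: "N (y n) \<le> C" for n
  proof -
    have "N (y n) \<le> (\<Sum>k<r n. N (l (r n) k *\<^sub>R x k))"
      unfolding y_def by (intro norm_sum_le scale_in_carrier x)
    also have "\<dots> \<le> (\<Sum>k<r n. \<bar>l0 (r n) k\<bar>)"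
      using x by (intro sum_mono) (simp add: norm_scale mult_left_le l_def)
    also have "\<dots> \<le> C" by (rule sum_l0) simp
    finally show ?thesis .
  qed
  have "N z \<le> C"
  proof (rule field_le_epsilon)
    fix \<epsilon> :: real assume "\<epsilon> > 0"
    then have "eventually (\<lambda>n. y n \<in> X \<and> N (y n - z) < \<epsilon>) sequentially"
      using lim unfolding limitin_norm_topology y_def by blast
    then obtain n where "N (y n - z) < \<epsilon>" by (auto simp: eventually_sequentially)
    then show "N z \<le> C + \<epsilon>"
      using norm_triangle_diff[OF z_X y_X[of n]] norm_minus_commute[OF z_X y_X[of n]] N_y[of n] by simp
  qed
  moreover have "w i / 2 * \<bar>\<phi> i (x i)\<bar> \<le> \<bar>\<phi> i z\<bar>" for i
  proof -
    have \<phi>_sum: "\<phi> i (\<Sum>k\<in>K. t k *\<^sub>R x k) = (\<Sum>k\<in>K. t k * \<phi> i (x k))" for K t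
    proof (induction K rule: infinite_finite_induct)
      case (insert k K)
      then show ?case by (simp add: add scale x sum_in_carrier scale_in_carrier)
    qed (use scale[of 0 i 0] subspace_0[OF subspace_carrier] in auto)
    have "(\<lambda>n. \<phi> i (y n)) \<longlonglongrightarrow> \<phi> i z"
      using continuous_map_limit[OF cont lim] by (simp add: o_def y_def)
    then have "(\<lambda>n. \<bar>\<phi> i (y n)\<bar>) \<longlonglongrightarrow> \<bar>\<phi> i z\<bar>" by (rule tendsto_rabs)
    moreover have "w i / 2 * \<bar>\<phi> i (x i)\<bar> \<le> \<bar>\<phi> i (y n)\<bar>" if "Suc i \<le> n" for n
    proof -
      have i: "i < r n" using that seq_suble[OF r, of n] by simp
      have "\<phi> i (y n) = (\<Sum>k<r n. H i k * l0 (r n) k) * \<phi> i (x i)"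
        unfolding y_def \<phi>_sum sum_distrib_right using nz
        by (intro sum.cong) (auto simp: H_def l_def)
      then show ?thesis
        using mult_right_mono[OF l0(1)[OF i], of "\<bar>\<phi> i (x i)\<bar>"] by (simp add: abs_mult)
    qed
    ultimately show ?thesis by (intro LIMSEQ_le_const) blast+
  qed
  ultimately show ?thesis using z_X unfolding C_def by blast
qed

end


section \<open>The norms of the partial sums operators cannot grow too fast\<close>

context normed_space_on begin

text \<open>
  Filter limits are additive and homogeneous; uniqueness of the expansion turns this into linearity of
  the coordinates.
\<close>

lemma filter_basis_coord:
  assumes F: "free_filter F" and basis: "filter_basis F X N u"
  shows "x \<in> X \<Longrightarrow> filter_expansion F X N u x (\<lambda>k. coord F X N u k x)"
    and "x \<in> X \<Longrightarrow> y \<in> X \<Longrightarrow> coord F X N u k (x + y) = coord F X N u k x + coord F X N u k y"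
    and "x \<in> X \<Longrightarrow> coord F X N u k (t *\<^sub>R x) = t * coord F X N u k x"
proof -
  have u: "u k \<in> X" for k using basis by (simp add: filter_basis_def)
  have ex1: "\<exists>!c. filter_expansion F X N u x c" if "x \<in> X" for x
    using basis that by (simp add: filter_basis_def)
  have the: "(\<lambda>k. coord F X N u k x) = (THE c. filter_expansion F X N u x c)" for x
    by (simp add: coord_def fun_eq_iff)
  show exp: "filter_expansion F X N u x (\<lambda>k. coord F X N u k x)" if "x \<in> X" for x
    unfolding the by (rule theI'[OF ex1[OF that]])
  have eq: "coord F X N u k x = c k" if "filter_expansion F X N u x c" "x \<in> X" for x c k
    using ex1[OF that(2)] exp[OF that(2)] that(1) by (metis (no_types, lifting))
  have S: "(\<Sum>k\<le>n. c k *\<^sub>R u k) \<in> X" for c n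
    by (intro sum_in_carrier scale_in_carrier u)
  show "coord F X N u k (x + y) = coord F X N u k x + coord F X N u k y" if x: "x \<in> X" and y: "y \<in> X"
  proof (rule eq)
    show "filter_expansion F X N u (x + y) (\<lambda>k. coord F X N u k x + coord F X N u k y)"
      unfolding filter_expansion_def limitin_norm_topology
    proof (intro conjI allI impI add_in_carrier x y)
      fix \<epsilon> :: real assume "\<epsilon> > 0"
      then have "\<epsilon> / 2 > 0" by simp
      have "eventually (\<lambda>n. N ((\<Sum>k\<le>n. coord F X N u k x *\<^sub>R u k) - x) < \<epsilon> / 2) F"
        "eventually (\<lambda>n. N ((\<Sum>k\<le>n. coord F X N u k y *\<^sub>R u k) - y) < \<epsilon> / 2) F"
        using \<open>\<epsilon> / 2 > 0\<close> by (intro filter_expansion_eventually exp x y; assumption)+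
      then show "eventually (\<lambda>n. (\<Sum>k\<le>n. (coord F X N u k x + coord F X N u k y) *\<^sub>R u k) \<in> X \<and>
          N ((\<Sum>k\<le>n. (coord F X N u k x + coord F X N u k y) *\<^sub>R u k) - (x + y)) < \<epsilon>) F"
      proof eventually_elim
        case (elim n)
        have eq: "(\<Sum>k\<le>n. (coord F X N u k x + coord F X N u k y) *\<^sub>R u k) - (x + y) =
          ((\<Sum>k\<le>n. coord F X N u k x *\<^sub>R u k) - x) + ((\<Sum>k\<le>n. coord F X N u k y *\<^sub>R u k) - y)"
          by (simp add: scaleR_add_left sum.distrib)
        have "N (((\<Sum>k\<le>n. coord F X N u k x *\<^sub>R u k) - x) + ((\<Sum>k\<le>n. coord F X N u k y *\<^sub>R u k) - y))
            < \<epsilon> / 2 + \<epsilon> / 2"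
          using norm_triangle[OF minus_in_carrier[OF S x] minus_in_carrier[OF S y]]
          by (rule order_le_less_trans) (rule add_strict_mono[OF elim])
        with S show ?case unfolding eq by simp
      qed
    qed
  qed (rule add_in_carrier[OF x y])
  show "coord F X N u k (t *\<^sub>R x) = t * coord F X N u k x" if x: "x \<in> X"
  proof (rule eq)
    show "filter_expansion F X N u (t *\<^sub>R x) (\<lambda>k. t * coord F X N u k x)"
      unfolding filter_expansion_def limitin_norm_topology
    proof (intro conjI allI impI scale_in_carrier x)
      fix \<epsilon> :: real assume "\<epsilon> > 0"
      then have "\<epsilon> / (\<bar>t\<bar> + 1) > 0" by simp
      then have "eventually (\<lambda>n. N ((\<Sum>k\<le>n. coord F X N u k x *\<^sub>R u k) - x) < \<epsilon> / (\<bar>t\<bar> + 1)) F"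
        using exp[OF x] by (rule filter_expansion_eventually[rotated])
      then show "eventually (\<lambda>n. (\<Sum>k\<le>n. (t * coord F X N u k x) *\<^sub>R u k) \<in> X \<and>
          N ((\<Sum>k\<le>n. (t * coord F X N u k x) *\<^sub>R u k) - t *\<^sub>R x) < \<epsilon>) F"
      proof eventually_elim
        case (elim n)
        define d where "d = (\<Sum>k\<le>n. coord F X N u k x *\<^sub>R u k) - x"
        have d: "d \<in> X" unfolding d_def by (rule minus_in_carrier[OF S x])
        have "(\<Sum>k\<le>n. (t * coord F X N u k x) *\<^sub>R u k) - t *\<^sub>R x = t *\<^sub>R d"
          by (simp add: d_def scaleR_diff_right scaleR_sum_right)
        moreover have "N (t *\<^sub>R d) \<le> (\<bar>t\<bar> + 1) * N d"
          using norm_nonneg[OF d] by (simp add: norm_scale[OF d] distrib_right)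
        moreover have "(\<bar>t\<bar> + 1) * N d < \<epsilon>"
          using elim by (simp add: d_def field_simps)
        ultimately show ?case using S by simp
      qed
    qed
  qed (rule scale_in_carrier[OF x])
qed

text \<open>
  This is valid even if \<open>S\<close> is unbounded: every upper bound of a nonempty set of reals bounds its
  supremum, so a real supremum that exceeds \<open>c\<close> excludes \<open>c\<close> as an upper bound.
\<close>

lemma op_norm_almost_attained:
  assumes "c < op_norm X N S"
  shows "\<exists>x\<in>X. N x \<le> 1 \<and> c < N (S x)"
proof (rule ccontr)
  assume "\<not> ?thesis"
  then have le: "N (S x) \<le> c" if "x \<in> X" "N x \<le> 1" for x using that by (auto simp: not_less)
  have "0 \<in> X" "N 0 \<le> 1"
    using subspace_0[OF subspace_carrier] norm_eq_0[of 0] by auto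
  then have "op_norm X N S \<le> c"
    unfolding op_norm_def using le by (intro cSUP_least) auto
  with assms show False by simp
qed

end

text \<open>
  If the series converged, the plank theorem would give a vector \<open>z\<close> of norm below \<open>1/4\<close> with
  \<open>N (S n z) \<ge> 1\<close> for all large \<open>n\<close>. Then \<open>S n z\<close> stays away from \<open>z\<close> on a cofinite set and cannot
  converge to \<open>z\<close> along a free filter.
\<close>

theorem inverse_partial_sum_norms_not_summable:
  fixes a :: "nat \<Rightarrow> real" and X :: "'v::real_vector set"
  assumes a: "\<And>n. 0 < a n" and F: "free_filter F" and X: "banach_space_on X N"
    and basis: "filter_basis F X N u" and cont: "continuous_coords F X N u"
    and norm: "\<And>n. op_norm X N (partial_sum_op F X N u n) = a n"
  shows "\<not> summable (\<lambda>n. inverse (a n))"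
proof
  assume sum: "summable (\<lambda>n. inverse (a n))"
  interpret banach_space_on X N by (rule X)
  let ?S = "partial_sum_op F X N u"
  note coord = filter_basis_coord[OF F basis]
  have u: "u k \<in> X" for k using basis by (simp add: filter_basis_def)
  have S_X: "?S n x \<in> X" for n x
    unfolding partial_sum_op_def by (intro sum_in_carrier scale_in_carrier u)
  have "eventually (\<lambda>M. (\<Sum>n. inverse (a (n + M))) < 1/16) sequentially"
    using suminf_exist_split2[OF sum] by (rule order_tendstoD) simp
  then obtain M where M: "(\<Sum>n. inverse (a (n + M))) < 1/16" by (auto simp: eventually_sequentially)
  have "\<exists>x\<in>X. N x \<le> 1 \<and> a n / 2 < N (?S n x)" for n
    using op_norm_almost_attained[of "a n / 2" "?S n"] norm[of n] a[of n] by simp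
  then obtain x where x: "\<And>n. x n \<in> X" "\<And>n. N (x n) \<le> 1" "\<And>n. a n / 2 < N (?S n (x n))"
    by metis
  have "\<exists>f :: 'v \<Rightarrow> real. linear f \<and> f (?S n (x n)) = N (?S n (x n)) \<and>
      (\<forall>z\<in>span (insert (?S n (x n)) (u ` {..n})). f z \<le> N z)" for n
    using S_X u by (intro norming_functional) auto
  then obtain f :: "nat \<Rightarrow> 'v \<Rightarrow> real" where f: "\<And>n. linear (f n)"
    "\<And>n. f n (?S n (x n)) = N (?S n (x n))"
    "\<And>n z. z \<in> span (insert (?S n (x n)) (u ` {..n})) \<Longrightarrow> f n z \<le> N z"
    by metis
  have S_span: "?S n y \<in> span (insert (?S n (x n)) (u ` {..n}))" for n y
    unfolding partial_sum_op_def by (intro span_sum span_scale span_base) auto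
  have f_le: "\<bar>f n (?S n y)\<bar> \<le> N (?S n y)" for n y
    using f(3)[OF S_span, of n y] f(3)[OF span_neg[OF S_span], of n y] norm_scale[OF S_X, of "-1" n y]
    by (simp add: linear_neg[OF f(1)] abs_le_iff)
  define \<phi> where "\<phi> i y = f (i + M) (?S (i + M) y)" for i y
  \<comment> \<open>The factor \<open>4\<close> makes up for the loss of \<open>2\<close> in the plank theorem and of \<open>2\<close> in the choice
    of \<open>x\<close>; the bound \<open>1/16\<close> then leaves a vector of norm below \<open>1/4\<close>.\<close>
  define w where "w i = 4 * inverse (a (i + M))" for i
  have sum_M: "summable (\<lambda>n. inverse (a (n + M)))" using sum summable_iff_shift[of "\<lambda>n. inverse (a n)" M] by simp
  have "\<exists>z\<in>X. N z \<le> suminf w \<and> (\<forall>i. w i / 2 * \<bar>\<phi> i (x (i + M))\<bar> \<le> \<bar>\<phi> i z\<bar>)"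
  proof (rule plank_theorem)
    show "\<phi> i (y + z) = \<phi> i y + \<phi> i z" if "y \<in> X" "z \<in> X" for i y z
      using that by (simp add: \<phi>_def partial_sum_op_def coord scaleR_add_left sum.distrib
          linear_add[OF f(1)])
    show "\<phi> i (t *\<^sub>R y) = t * \<phi> i y" if "y \<in> X" for i t y
    proof -
      have "?S (i + M) (t *\<^sub>R y) = t *\<^sub>R ?S (i + M) y"
        using that by (simp add: partial_sum_op_def coord scaleR_sum_right)
      then show ?thesis by (simp add: \<phi>_def linear_cmul[OF f(1)])
    qed
    show "continuous_map (norm_topology X N) euclideanreal (\<phi> i)" for i
    proof -
      have "\<phi> i = (\<lambda>y. \<Sum>k\<le>i + M. coord F X N u k y * f (i + M) (u k))"
        by (simp add: \<phi>_def partial_sum_op_def linear_sum[OF f(1)] linear_cmul[OF f(1)] fun_eq_iff)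
      moreover have "continuous_map (norm_topology X N) euclideanreal (coord F X N u k)" for k
        using cont by (simp add: continuous_coords_def)
      ultimately show ?thesis by (auto intro!: continuous_intros)
    qed
    show "\<phi> i (x (i + M)) \<noteq> 0" for i
      using x(3)[of "i + M"] a[of "i + M"] by (simp add: \<phi>_def f(2))
    show "summable w" unfolding w_def using sum_M by (rule summable_mult)
    show "0 < w i" for i using a by (simp add: w_def)
  qed (rule x)+
  then obtain z where z: "z \<in> X" "N z \<le> suminf w"
    and large: "\<And>i. w i / 2 * \<bar>\<phi> i (x (i + M))\<bar> \<le> \<bar>\<phi> i z\<bar>" by blast
  have "suminf w = 4 * (\<Sum>n. inverse (a (n + M)))"
    unfolding w_def using sum_M by (rule suminf_mult)
  with z(2) M have N_z: "N z < 1/4" by simp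
  have "1 \<le> N (?S n z)" if "M \<le> n" for n
  proof -
    obtain i where i: "n = i + M" using \<open>M \<le> n\<close> by (metis le_Suc_ex add.commute)
    have "1 = w i / 2 * (a n / 2)" using a[of n] by (simp add: w_def i)
    also have "\<dots> \<le> w i / 2 * \<bar>\<phi> i (x (i + M))\<bar>"
      using x(3)[of n] a[of n] by (intro mult_left_mono) (auto simp: \<phi>_def f(2) w_def i)
    also have "\<dots> \<le> \<bar>\<phi> i z\<bar>" by (rule large)
    also have "\<dots> \<le> N (?S n z)" using f_le[of n z] by (simp add: \<phi>_def i)
    finally show ?thesis .
  qed
  then have "eventually (\<lambda>n. 1 \<le> N (?S n z)) F"
    by (rule eventually_mono[OF
          filter_leD[OF free_filter_le_sequentially[OF F] eventually_ge_at_top[of M]]])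
  moreover have "eventually (\<lambda>n. N (?S n z - z) < 1/2) F"
    using filter_expansion_eventually[OF coord(1)[OF z(1)], of "1/2"] by (simp add: partial_sum_op_def)
  ultimately have "eventually (\<lambda>n. False) F"
  proof eventually_elim
    case (elim n)
    then show ?case using norm_triangle_diff[OF S_X z(1), of n z] N_z by simp
  qed
  then show False using F by (simp add: free_filter_def)
qed


section \<open>A criterion for filter bases\<close>

context normed_space_on begin

text \<open>
  A criterion in the spirit of biorthogonal systems: expansions with coefficients \<open>L k x\<close> exist, and
  they are unique because each continuous functional \<open>L k\<close> reads off the coefficient \<open>c k\<close> from all
  sufficiently late partial sums.
\<close>

lemma filter_basisI:
  assumes F: "F \<noteq> bot" and u: "\<And>k. u k \<in> X"
    and lim: "\<And>x. x \<in> X \<Longrightarrow> filter_expansion F X N u x (\<lambda>k. L k x)"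
    and dual: "\<And>k n c. k \<le> n \<Longrightarrow> L k (\<Sum>j\<le>n. c j *\<^sub>R u j) = c k"
    and lip: "\<And>k x y. x \<in> X \<Longrightarrow> y \<in> X \<Longrightarrow> \<bar>L k x - L k y\<bar> \<le> C k * N (x - y)"
    and F_seq: "F \<le> sequentially"
  shows "filter_basis F X N u" "continuous_coords F X N u"
    "x \<in> X \<Longrightarrow> coord F X N u k x = L k x"
proof -
  have uniq: "c = (\<lambda>k. L k x)" if "filter_expansion F X N u x c" for c x
  proof
    fix k
    have x: "x \<in> X" using that unfolding filter_expansion_def limitin_norm_topology by blast
    note ev = filter_expansion_eventually[OF that]
    have "\<bar>c k - L k x\<bar> \<le> 0 + \<delta>" if "\<delta> > 0" for \<delta>
    proof -
      have "\<delta> / (\<bar>C k\<bar> + 1) > 0" using that by simp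
      note ev[OF this]
      moreover have "eventually (\<lambda>n. k \<le> n) F"
        using F_seq eventually_ge_at_top[of k] by (rule filter_leD)
      ultimately have "eventually (\<lambda>n. N ((\<Sum>j\<le>n. c j *\<^sub>R u j) - x) < \<delta> / (\<bar>C k\<bar> + 1) \<and> k \<le> n) F"
        by (rule eventually_conj)
      then obtain n where n: "N ((\<Sum>j\<le>n. c j *\<^sub>R u j) - x) < \<delta> / (\<bar>C k\<bar> + 1)" "k \<le> n"
        using eventually_happens F by blast
      have S: "(\<Sum>j\<le>n. c j *\<^sub>R u j) \<in> X"
        by (intro sum_in_carrier scale_in_carrier u)
      have "\<bar>c k - L k x\<bar> \<le> C k * N ((\<Sum>j\<le>n. c j *\<^sub>R u j) - x)"
        using lip[OF S x, of k] dual[OF n(2)] by simp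
      also have "\<dots> \<le> (\<bar>C k\<bar> + 1) * N ((\<Sum>j\<le>n. c j *\<^sub>R u j) - x)"
        by (intro mult_right_mono norm_nonneg subspace_diff[OF subspace_carrier] S x) simp
      also have "\<dots> \<le> (\<bar>C k\<bar> + 1) * (\<delta> / (\<bar>C k\<bar> + 1))"
        using n(1) by (intro mult_left_mono) auto
      also have "\<dots> = \<delta>" by simp
      finally show ?thesis by simp
    qed
    then have "\<bar>c k - L k x\<bar> \<le> 0" by (rule field_le_epsilon)
    then show "c k = L k x" by simp
  qed
  show "filter_basis F X N u"
    unfolding filter_basis_def using u lim uniq by blast
  have coord: "coord F X N u k x = L k x" if "x \<in> X" for k x
  proof -
    have "(THE c. filter_expansion F X N u x c) = (\<lambda>k. L k x)"
      using lim[OF that] uniq by (rule the_equality)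
    then show ?thesis by (simp add: coord_def)
  qed
  then show "x \<in> X \<Longrightarrow> coord F X N u k x = L k x" .
  show "continuous_coords F X N u"
    unfolding continuous_coords_def
  proof
    fix k
    have "continuous_map (norm_topology X N) euclideanreal (L k)"
      unfolding continuous_map_def norm_topology_def topspace_mtopology
    proof (intro conjI allI impI)
      fix U :: "real set" assume U: "openin euclideanreal U"
      show "openin mtopology {x \<in> X. L k x \<in> U}"
        unfolding openin_mtopology
      proof (intro conjI allI impI)
        fix x assume "x \<in> {x \<in> X. L k x \<in> U}"
        then have x: "x \<in> X" "L k x \<in> U" by auto
        with U obtain e where e: "e > 0" "\<And>t. dist t (L k x) < e \<Longrightarrow> t \<in> U"
          unfolding open_openin[symmetric] open_dist by blast
        have "mball x (e / (\<bar>C k\<bar> + 1)) \<subseteq> {x \<in> X. L k x \<in> U}"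
        proof
          fix y assume "y \<in> mball x (e / (\<bar>C k\<bar> + 1))"
          then have y: "y \<in> X" "N (x - y) < e / (\<bar>C k\<bar> + 1)"
            using x by (auto simp: in_mball norm_dist_def)
          have "\<bar>L k x - L k y\<bar> \<le> C k * N (x - y)" by (rule lip[OF x(1) y(1)])
          also have "\<dots> \<le> (\<bar>C k\<bar> + 1) * N (x - y)"
            by (intro mult_right_mono norm_nonneg subspace_diff[OF subspace_carrier] x y) simp
          also have "\<dots> < (\<bar>C k\<bar> + 1) * (e / (\<bar>C k\<bar> + 1))"
            using y(2) by (intro mult_strict_left_mono) auto
          also have "\<dots> = e" by simp
          finally have "L k y \<in> U" by (intro e(2)) (simp add: dist_real_def abs_minus_commute)
          with y show "y \<in> {x \<in> X. L k x \<in> U}" by simp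
        qed
        then show "\<exists>r>0. mball x r \<subseteq> {x \<in> X. L k x \<in> U}"
          using e(1) by (intro exI[of _ "e / (\<bar>C k\<bar> + 1)"]) simp
      qed auto
    qed auto
    then show "continuous_map (norm_topology X N) euclideanreal (coord F X N u k)"
      by (rule continuous_map_eq) (simp add: coord norm_topology_def)
  qed
qed

end


section \<open>A basis of the absolutely summable sequences with prescribed norms\<close>

definition unit_seq :: "nat \<Rightarrow> nat \<Rightarrow> real" where
  "unit_seq n = (\<lambda>k. if k = n then 1 else 0)"

definition truncate_seq :: "nat \<Rightarrow> (nat \<Rightarrow> real) \<Rightarrow> nat \<Rightarrow> real" where
  "truncate_seq n x = (\<lambda>k. if k \<le> n then x k else 0)"

lemma l1_finite_support:
  assumes "\<And>k. n < k \<Longrightarrow> x k = 0"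
  shows "x \<in> l1_space" "l1_norm x = (\<Sum>k\<le>n. \<bar>x k\<bar>)"
proof -
  have fin: "\<And>k. k \<notin> {..n} \<Longrightarrow> \<bar>x k\<bar> = 0" using assms by auto
  show "x \<in> l1_space"
    unfolding l1_space_def using summable_finite[of "{..n}", OF _ fin] by simp
  show "l1_norm x = (\<Sum>k\<le>n. \<bar>x k\<bar>)"
    unfolding l1_norm_def using suminf_finite[of "{..n}", OF _ fin] by simp
qed

lemma l1_partial_le: "x \<in> l1_space \<Longrightarrow> finite A \<Longrightarrow> (\<Sum>k\<in>A. \<bar>x k\<bar>) \<le> l1_norm x"
  unfolding l1_space_def l1_norm_def by (intro sum_le_suminf) auto

lemma infinite_dimensional_l1: "infinite_dimensional l1_space"
  unfolding infinite_dimensional_def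
proof
  assume "\<exists>B. finite B \<and> l1_space \<subseteq> span B"
  then obtain B where B: "finite B" "l1_space \<subseteq> span B" by blast
  have inj: "inj unit_seq"
  proof (rule injI)
    fix m n assume "unit_seq m = unit_seq n"
    then have "unit_seq m m = unit_seq n m" by simp
    then show "m = n" by (simp add: unit_seq_def split: if_splits)
  qed
  have "independent (range unit_seq)"
    unfolding independent_explicit_module
  proof (intro allI impI)
    fix T and c :: "(nat \<Rightarrow> real) \<Rightarrow> real" and v
    assume T: "finite T" "T \<subseteq> range unit_seq" and z: "(\<Sum>v\<in>T. c v *\<^sub>R v) = 0" and v: "v \<in> T"
    obtain m where m: "v = unit_seq m" using T(2) v by blast
    have "0 = (\<Sum>v\<in>T. c v *\<^sub>R v) m" using z by simp
    also have "\<dots> = (\<Sum>v\<in>T. c v * v m)"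
      using T(1) by (induction rule: finite_induct) auto
    also have "\<dots> = (\<Sum>w\<in>T. if w = v then c v else 0)"
      using T(2) m inj by (intro sum.cong refl) (auto simp: unit_seq_def dest: injD split: if_splits)
    also have "\<dots> = c v" using T(1) v by simp
    finally show "c v = 0" by simp
  qed
  moreover have "range unit_seq \<subseteq> l1_space"
    using l1_finite_support(1)[of n "unit_seq n" for n] by (auto simp: unit_seq_def)
  ultimately have "finite (range unit_seq)"
    using independent_span_bound[OF B(1)] B(2) by blast
  then show False using inj finite_imageD by blast
qed

primrec chain_basis :: "(nat \<Rightarrow> real) \<Rightarrow> nat \<Rightarrow> nat \<Rightarrow> real" where
  "chain_basis b 0 = unit_seq 0"
| "chain_basis b (Suc n) = unit_seq (Suc n) - b n *\<^sub>R chain_basis b n"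

text \<open>
  The functionals biorthogonal to \<open>chain_basis b\<close>.
\<close>

definition chain_coeff :: "(nat \<Rightarrow> real) \<Rightarrow> nat \<Rightarrow> (nat \<Rightarrow> real) \<Rightarrow> real" where
  "chain_coeff b k x = x k + b k * x (Suc k)"

lemma chain_basis_support: "n < k \<Longrightarrow> chain_basis b n k = 0"
  by (induction n) (auto simp: unit_seq_def)

lemma chain_basis_dual: "chain_coeff b m (chain_basis b k) = (if k = m then 1 else 0)"
proof (induction k)
  case 0
  then show ?case by (auto simp: chain_coeff_def unit_seq_def)
next
  case (Suc k)
  have "chain_coeff b m (chain_basis b (Suc k)) =
      chain_coeff b m (unit_seq (Suc k)) - b k * chain_coeff b m (chain_basis b k)"
    by (simp add: chain_coeff_def algebra_simps)
  then show ?case using Suc by (auto simp: chain_coeff_def unit_seq_def)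
qed

lemma l1_chain_basis: "chain_basis b n \<in> l1_space"
  using chain_basis_support by (rule l1_finite_support(1))

lemma l1_norm_chain_basis_0: "l1_norm (chain_basis b 0) = 1"
  by (subst l1_finite_support(2)[of 0]) (auto simp: unit_seq_def)

lemma l1_norm_chain_basis_Suc:
  "l1_norm (chain_basis b (Suc n)) = 1 + \<bar>b n\<bar> * l1_norm (chain_basis b n)"
proof -
  have "l1_norm (chain_basis b (Suc n)) = (\<Sum>k\<le>Suc n. \<bar>chain_basis b (Suc n) k\<bar>)"
    using chain_basis_support by (rule l1_finite_support(2))
  also have "\<dots> = 1 + (\<Sum>k\<le>n. \<bar>b n\<bar> * \<bar>chain_basis b n k\<bar>)"
    by (simp add: chain_basis_support) (simp add: unit_seq_def abs_mult)
  also have "\<dots> = 1 + \<bar>b n\<bar> * l1_norm (chain_basis b n)"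
    using l1_finite_support(2)[OF chain_basis_support] by (simp add: sum_distrib_left)
  finally show ?thesis .
qed

text \<open>
  The sum telescopes because \<open>unit_seq (Suc n) = chain_basis b (Suc n) + b n *\<^sub>R chain_basis b n\<close>. The
  last summand is the whole difference between the partial sums operator and the truncation.
\<close>

lemma chain_partial_sum:
  "(\<Sum>k\<le>n. chain_coeff b k x *\<^sub>R chain_basis b k) =
     truncate_seq n x + (b n * x (Suc n)) *\<^sub>R chain_basis b n"
proof (induction n)
  case 0
  show ?case by (auto simp: fun_eq_iff chain_coeff_def truncate_seq_def unit_seq_def)
next
  case (Suc n)
  have "truncate_seq (Suc n) x = truncate_seq n x + x (Suc n) *\<^sub>R unit_seq (Suc n)"
    by (auto simp: fun_eq_iff truncate_seq_def unit_seq_def le_Suc_eq)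
  with Suc show ?case
    by (simp add: chain_coeff_def fun_eq_iff algebra_simps)
qed

lemma chain_coeff_sum:
  assumes "k \<le> n"
  shows "chain_coeff b k (\<Sum>j\<le>n. c j *\<^sub>R chain_basis b j) = c k"
proof -
  have "chain_coeff b k (\<Sum>j\<in>J. c j *\<^sub>R chain_basis b j) =
     (\<Sum>j\<in>J. c j * chain_coeff b k (chain_basis b j))" if "finite J" for J
    using that by (induction rule: finite_induct) (auto simp: chain_coeff_def algebra_simps)
  then show ?thesis using assms by (simp add: chain_basis_dual if_distrib cong: if_cong)
qed

lemma l1_norm_tail_tendsto:
  assumes "x \<in> l1_space"
  shows "(\<lambda>n. l1_norm (x - truncate_seq n x)) \<longlonglongrightarrow> 0"
proof -
  have sum: "summable (\<lambda>k. \<bar>x k\<bar>)" using assms by (simp add: l1_space_def)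
  have "l1_norm (x - truncate_seq n x) = l1_norm x - (\<Sum>k\<le>n. \<bar>x k\<bar>)" for n
  proof -
    have t: "truncate_seq n x \<in> l1_space" "l1_norm (truncate_seq n x) = (\<Sum>k\<le>n. \<bar>x k\<bar>)"
      using l1_finite_support[of n "truncate_seq n x"] by (auto simp: truncate_seq_def)
    have "l1_norm (x - truncate_seq n x) = (\<Sum>k. \<bar>x k\<bar> - \<bar>truncate_seq n x k\<bar>)"
      unfolding l1_norm_def by (intro arg_cong[of _ _ suminf]) (auto simp: truncate_seq_def)
    also have "\<dots> = l1_norm x - l1_norm (truncate_seq n x)"
      using sum t(1) unfolding l1_norm_def l1_space_def by (intro suminf_diff[symmetric]) auto
    finally show ?thesis unfolding t(2) .
  qed
  moreover have "(\<lambda>n. l1_norm x - (\<Sum>k\<le>n. \<bar>x k\<bar>)) \<longlonglongrightarrow> l1_norm x - l1_norm x"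
    unfolding l1_norm_def by (intro tendsto_intros summable_LIMSEQ' sum)
  ultimately show ?thesis by simp
qed

text \<open>
  The error term \<open>b n * x (Suc n) *\<^sub>R u n\<close> has norm \<open>a n * \<bar>x (Suc n)\<bar>\<close>. It may be large for infinitely
  many \<open>n\<close>, but only on a set on which \<open>inverse (a n)\<close> is dominated by a multiple of the summable
  sequence \<open>\<bar>x (Suc n)\<bar>\<close>, and such sets are null for the summable filter. The norm of an operator
  on this space is the largest norm of a column: \<open>S n\<close> fixes the first unit vectors, maps the one with
  index \<open>Suc n\<close> to a vector of norm \<open>a n > 1\<close>, and annihilates the others.
\<close>

theorem l1_filter_basis_with_partial_sum_norms:
  fixes a :: "nat \<Rightarrow> real"
  assumes a: "\<And>n. 1 < a n" and div: "\<not> summable (\<lambda>n. inverse (a n))"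
  defines "F \<equiv> summable_filter (\<lambda>n. inverse (a n))"
  shows "\<exists>u. filter_basis F l1_space l1_norm u \<and> continuous_coords F l1_space l1_norm u \<and>
    (\<forall>n. op_norm l1_space l1_norm (partial_sum_op F l1_space l1_norm u n) = a n)"
proof -
  interpret l1: normed_space_on l1_space l1_norm by (rule normed_space_on_l1)
  have a_pos: "0 < a n" for n using a[of n] by simp
  \<comment> \<open>The solution of \<open>b n * l1_norm (u n) = a n\<close>, because \<open>l1_norm (u (Suc n)) = 1 + a n\<close>.\<close>
  define b where "b n = (case n of 0 \<Rightarrow> a 0 | Suc m \<Rightarrow> a (Suc m) / (1 + a m))" for n
  define u where "u = chain_basis b"
  have b_pos: "0 < b n" for n
    using a_pos by (auto simp: b_def add_pos_pos split: nat.split)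
  have bu: "b n * l1_norm (u n) = a n" for n
  proof (induction n)
    case 0
    then show ?case by (simp add: b_def u_def l1_norm_chain_basis_0 del: chain_basis.simps)
  next
    case (Suc n)
    have "l1_norm (u (Suc n)) = 1 + a n"
      using Suc b_pos[of n] by (simp add: u_def l1_norm_chain_basis_Suc del: chain_basis.simps)
    moreover have "1 + a n \<noteq> 0" using a_pos[of n] by simp
    ultimately show ?case by (simp add: b_def)
  qed
  have u_l1: "u n \<in> l1_space" for n unfolding u_def by (rule l1_chain_basis)
  have free: "free_filter F"
    unfolding F_def using a_pos div by (intro free_filter_summable_filter) (auto intro: less_imp_le)
  then have F: "F \<noteq> bot" by (simp add: free_filter_def)
  note F_seq = free_filter_le_sequentially[OF free]
  have trunc: "truncate_seq n x \<in> l1_space" "l1_norm (truncate_seq n x) = (\<Sum>k\<le>n. \<bar>x k\<bar>)" for n x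
    using l1_finite_support[of n "truncate_seq n x"] by (auto simp: truncate_seq_def)
  have err: "l1_norm ((b n * t) *\<^sub>R u n) = a n * \<bar>t\<bar>" for n t
    using bu[of n] b_pos[of n] by (simp add: l1.norm_scale[OF u_l1] abs_mult)
  have small: "eventually (\<lambda>n. a n * \<bar>x (Suc n)\<bar> < \<epsilon>) F" if x: "x \<in> l1_space" and "\<epsilon> > 0" for x \<epsilon>
  proof -
    have "summable (\<lambda>n. \<bar>x (Suc n)\<bar> / \<epsilon>)"
      using x unfolding l1_space_def by (intro summable_divide) (simp add: summable_Suc_iff[of "\<lambda>k. \<bar>x k\<bar>"])
    then have "(\<lambda>n. \<bar>x (Suc n)\<bar> / \<epsilon>) summable_on UNIV"
      using \<open>\<epsilon> > 0\<close> by (subst summable_on_UNIV_nonneg_real_iff) auto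
    then have "(\<lambda>n. \<bar>x (Suc n)\<bar> / \<epsilon>) summable_on {n. \<not> a n * \<bar>x (Suc n)\<bar> < \<epsilon>}"
      by (rule summable_on_subset_banach) simp
    then have "(\<lambda>n. inverse (a n)) summable_on {n. \<not> a n * \<bar>x (Suc n)\<bar> < \<epsilon>}"
      using a_pos \<open>\<epsilon> > 0\<close>
      by (rule_tac summable_on_comparison_test) (auto simp: field_simps less_imp_le not_less)
    then show ?thesis by (simp add: F_def eventually_summable_filter)
  qed
  have expansion: "filter_expansion F l1_space l1_norm u x (\<lambda>k. chain_coeff b k x)"
    if x: "x \<in> l1_space" for x
    unfolding filter_expansion_def l1.limitin_norm_topology
  proof (intro conjI allI impI x)
    fix \<epsilon> :: real assume "\<epsilon> > 0"
    then have "\<epsilon> / 2 > 0" by simp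
    have "eventually (\<lambda>n. l1_norm (x - truncate_seq n x) < \<epsilon> / 2) sequentially"
      using l1_norm_tail_tendsto[OF x] \<open>\<epsilon> / 2 > 0\<close> by (rule order_tendstoD)
    with F_seq have "eventually (\<lambda>n. l1_norm (x - truncate_seq n x) < \<epsilon> / 2) F"
      by (rule filter_leD)
    with small[OF x \<open>\<epsilon> / 2 > 0\<close>]
    show "eventually (\<lambda>n. (\<Sum>k\<le>n. chain_coeff b k x *\<^sub>R u k) \<in> l1_space \<and>
            l1_norm ((\<Sum>k\<le>n. chain_coeff b k x *\<^sub>R u k) - x) < \<epsilon>) F"
    proof eventually_elim
      case (elim n)
      have S: "(\<Sum>k\<le>n. chain_coeff b k x *\<^sub>R u k) - x =
          (b n * x (Suc n)) *\<^sub>R u n + (-1) *\<^sub>R (x - truncate_seq n x)"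
        unfolding u_def chain_partial_sum by (simp add: fun_eq_iff)
      have d: "x - truncate_seq n x \<in> l1_space"
        by (rule subspace_diff[OF l1.subspace_carrier x trunc(1)])
      have "l1_norm ((\<Sum>k\<le>n. chain_coeff b k x *\<^sub>R u k) - x) \<le>
          a n * \<bar>x (Suc n)\<bar> + l1_norm (x - truncate_seq n x)"
        using l1.norm_triangle[OF l1.scale_in_carrier[OF u_l1] l1.scale_in_carrier[OF d, of "-1"],
            of "b n * x (Suc n)" n]
        unfolding S err l1.norm_scale[OF d] by simp
      then show ?case
        using elim by (auto intro!: l1.sum_in_carrier l1.scale_in_carrier u_l1)
    qed
  qed
  have dual: "chain_coeff b k (\<Sum>j\<le>n. c j *\<^sub>R u j) = c k" if "k \<le> n" for k n c
    unfolding u_def using that by (rule chain_coeff_sum)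
  have lip: "\<bar>chain_coeff b k x - chain_coeff b k y\<bar> \<le> (1 + b k) * l1_norm (x - y)"
    if "x \<in> l1_space" "y \<in> l1_space" for k x y
  proof -
    have d: "x - y \<in> l1_space" by (rule subspace_diff[OF l1.subspace_carrier that])
    have le: "\<bar>x j - y j\<bar> \<le> l1_norm (x - y)" for j
      using l1_partial_le[OF d, of "{j}"] by simp
    have "\<bar>chain_coeff b k x - chain_coeff b k y\<bar> = \<bar>(x k - y k) + b k * (x (Suc k) - y (Suc k))\<bar>"
      by (simp add: chain_coeff_def algebra_simps)
    also have "\<dots> \<le> \<bar>x k - y k\<bar> + b k * \<bar>x (Suc k) - y (Suc k)\<bar>"
      using abs_triangle_ineq[of "x k - y k" "b k * (x (Suc k) - y (Suc k))"] b_pos[of k]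
      by (simp add: abs_mult)
    also have "\<dots> \<le> l1_norm (x - y) + b k * l1_norm (x - y)"
      using b_pos[of k] by (intro add_mono mult_left_mono le) auto
    finally show ?thesis by (simp add: algebra_simps)
  qed
  have basis: "filter_basis F l1_space l1_norm u"
    using F u_l1 expansion dual lip F_seq by (rule l1.filter_basisI)
  have continuous: "continuous_coords F l1_space l1_norm u"
    using F u_l1 expansion dual lip F_seq by (rule l1.filter_basisI)
  have coord_u: "coord F l1_space l1_norm u k x = chain_coeff b k x" if "x \<in> l1_space" for k x
    using F u_l1 expansion dual lip F_seq that by (rule l1.filter_basisI)
  have S: "partial_sum_op F l1_space l1_norm u n x = truncate_seq n x + (b n * x (Suc n)) *\<^sub>R u n"
    if "x \<in> l1_space" for n x
    unfolding partial_sum_op_def coord_u[OF that] unfolding u_def by (rule chain_partial_sum)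
  have "op_norm l1_space l1_norm (partial_sum_op F l1_space l1_norm u n) = a n" for n
    unfolding op_norm_def
  proof (rule cSup_eq_maximum)
    have e: "unit_seq (Suc n) \<in> l1_space" "l1_norm (unit_seq (Suc n)) = 1"
      using l1_finite_support[of "Suc n" "unit_seq (Suc n)"] by (auto simp: unit_seq_def)
    have "truncate_seq n (unit_seq (Suc n)) = 0"
      by (auto simp: truncate_seq_def unit_seq_def fun_eq_iff)
    then have "l1_norm (partial_sum_op F l1_space l1_norm u n (unit_seq (Suc n))) = a n"
      using err[of n 1] unfolding S[OF e(1)] by (simp add: unit_seq_def)
    then show "a n \<in> (\<lambda>x. l1_norm (partial_sum_op F l1_space l1_norm u n x)) `
        {x \<in> l1_space. l1_norm x \<le> 1}"
      using e by (intro image_eqI[of _ _ "unit_seq (Suc n)"]) auto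
  next
    fix r assume "r \<in> (\<lambda>x. l1_norm (partial_sum_op F l1_space l1_norm u n x)) `
        {x \<in> l1_space. l1_norm x \<le> 1}"
    then obtain x where x: "x \<in> l1_space" "l1_norm x \<le> 1"
      and r: "r = l1_norm (truncate_seq n x + (b n * x (Suc n)) *\<^sub>R u n)"
      by (auto simp: S)
    have "r \<le> (\<Sum>k\<le>n. \<bar>x k\<bar>) + a n * \<bar>x (Suc n)\<bar>"
      using l1.norm_triangle[OF trunc(1) l1.scale_in_carrier[OF u_l1]] unfolding r
      by (metis err trunc(2))
    also have "\<dots> \<le> a n * (\<Sum>k\<le>n. \<bar>x k\<bar>) + a n * \<bar>x (Suc n)\<bar>"
      using mult_right_mono[OF less_imp_le[OF a[of n]], of "\<Sum>k\<le>n. \<bar>x k\<bar>"]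
      by (simp add: sum_nonneg)
    also have "\<dots> = a n * (\<Sum>k\<le>Suc n. \<bar>x k\<bar>)" by (simp add: algebra_simps)
    also have "\<dots> \<le> a n * 1"
      using l1_partial_le[OF x(1), of "{..Suc n}"] x(2) a_pos[of n] by (intro mult_left_mono) auto
    finally show "r \<le> a n" by simp
  qed
  with basis continuous show ?thesis by blast
qed


section \<open>The equivalence\<close>

theorem theorem5p4:
  fixes a :: "nat \<Rightarrow> real"
  assumes "\<And>n. 1 < a n"
  shows
    "(\<not> summable (\<lambda>n. inverse (a n)) \<longleftrightarrow>
       (\<exists>F (X :: (nat \<Rightarrow> real) set) N u.
          free_filter F \<and> banach_space_on X N \<and> infinite_dimensional X \<and>
          filter_basis F X N u \<and> continuous_coords F X N u \<and>
          (\<forall>n. op_norm X N (partial_sum_op F X N u n) = a n))) \<and>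
     (\<not> summable (\<lambda>n. inverse (a n)) \<longleftrightarrow>
       (let s = (\<lambda>n. inverse (a n)); F = summable_filter s in
          \<not> summable s \<and>
          (\<exists>u. filter_basis F l1_space l1_norm u \<and> continuous_coords F l1_space l1_norm u \<and>
            (\<forall>n. op_norm l1_space l1_norm (partial_sum_op F l1_space l1_norm u n) = a n)))) \<and>
     ((\<exists>F (X :: 'v::real_vector set) N u.
          free_filter F \<and> banach_space_on X N \<and> infinite_dimensional X \<and>
          filter_basis F X N u \<and> continuous_coords F X N u \<and>
          (\<forall>n. op_norm X N (partial_sum_op F X N u n) = a n)) \<longrightarrow>
       \<not> summable (\<lambda>n. inverse (a n)))"
proof -
  let ?div = "\<not> summable (\<lambda>n. inverse (a n))"
  let ?F = "summable_filter (\<lambda>n. inverse (a n))"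
  have pos: "0 < a n" for n using assms[of n] by simp
  note necessary = inverse_partial_sum_norms_not_summable[where a = a, OF pos]
  have l1: "\<exists>u. filter_basis ?F l1_space l1_norm u \<and> continuous_coords ?F l1_space l1_norm u \<and>
      (\<forall>n. op_norm l1_space l1_norm (partial_sum_op ?F l1_space l1_norm u n) = a n)" if ?div
    using assms that by (rule l1_filter_basis_with_partial_sum_norms)
  have free: "free_filter ?F" if ?div
    using that by (intro free_filter_summable_filter) (simp_all add: less_imp_le pos)
  show ?thesis
    unfolding Let_def
  proof (intro conjI)
    show "?div \<longleftrightarrow>
       (\<exists>F (X :: (nat \<Rightarrow> real) set) N u.
          free_filter F \<and> banach_space_on X N \<and> infinite_dimensional X \<and>
          filter_basis F X N u \<and> continuous_coords F X N u \<and>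
          (\<forall>n. op_norm X N (partial_sum_op F X N u n) = a n))"
      (is "_ \<longleftrightarrow> ?ex")
    proof
      assume ?div
      from l1[OF this] obtain u where "filter_basis ?F l1_space l1_norm u \<and>
        continuous_coords ?F l1_space l1_norm u \<and>
        (\<forall>n. op_norm l1_space l1_norm (partial_sum_op ?F l1_space l1_norm u n) = a n)" ..
      with free[OF \<open>?div\<close>] banach_space_on_l1 infinite_dimensional_l1 show ?ex
        by (intro exI[of _ ?F] exI[of _ l1_space] exI[of _ l1_norm] exI[of _ u] conjI) simp_all
    next
      assume ?ex
      then show ?div by (elim exE conjE) (rule necessary, assumption+, erule spec)
    qed
    show "?div \<longleftrightarrow> ?div \<and>
      (\<exists>u. filter_basis ?F l1_space l1_norm u \<and> continuous_coords ?F l1_space l1_norm u \<and>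
        (\<forall>n. op_norm l1_space l1_norm (partial_sum_op ?F l1_space l1_norm u n) = a n))"
      using l1 by blast
    show "(\<exists>F (X :: 'v set) N u.
          free_filter F \<and> banach_space_on X N \<and> infinite_dimensional X \<and>
          filter_basis F X N u \<and> continuous_coords F X N u \<and>
          (\<forall>n. op_norm X N (partial_sum_op F X N u n) = a n)) \<longrightarrow> ?div"
      by (intro impI, elim exE conjE) (rule necessary, assumption+, erule spec)
  qed
qed


end
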